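(* Let $r\in\{1,2\}$, $p,q>0$, and let $F_{\gamma_d}$ be the cumulative distribution function of the instantaneous SNR $\gamma_d$ of the destination link defined in the context. Then the average bit error rate $$\mathrm{ABER}=\frac{q^{p}}{2\Gamma(p)}\int_0^\infty e^{-q\gamma}\gamma^{p-1}F_{\gamma_d}(\gamma)\,d\gamma$$ equals $$\mathrm{ABER}=\frac{\Lambda_{3,d}\,q^{-l_d/r}}{2\sqrt r\,\Gamma(p)\,\mu_{r,d}^{l_d/r}}\;G_{2,r+1}^{r,2}\left[\frac{\Lambda_{4,d}}{q\,\mu_{r,d}}\,\middle|\,\begin{array}{c}1-p-\frac{l_d}{r},\,1-\frac{l_d}{r}\\ 0,\frac{r-1}{r},-\frac{l_d}{r}\end{array}\right].$$
   Context: Meijer's G function: $G^{m,n}_{p',q'}\left[z\,\middle|\,\begin{array}{c}a_1,\dots,a_{p'}\\ b_1,\dots,b_{q'}\end{array}\right]=\frac{1}{2\pi i}\int_{L}\frac{\prod_{i=1}^{m}\Gamma(b_i+s)\prod_{i=1}^{n}\Gamma(1-a_i-s)}{\prod_{i=n+1}^{p'}\Gamma(a_i+s)\prod_{i=m+1}^{q'}\Gamma(1-b_i-s)}z^{-s}\,ds$, where $L$ separates the poles of the $\Gamma(b_i+s)$ ($i\le m$) from those of the $\Gamma(1-a_i-s)$ ($i\le n$). In a parameter list, "$0,\frac{r-1}{r}$" denotes the single entry $0$ if $r=1$, and $0,\frac12$ if $r=2$. Model. $M$ is a positive random variable (the two-hop channel gain through one reflecting element of the reconfigurable intelligent surface: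 a product of two independent inverted Gamma-Gamma turbulence variables with pointing errors) with mean $E=\mathbb{E}(M)>0$ and variance $0<\mathrm{Var}(M)<\infty$; only $E$ and $\mathrm{Var}(M)$ enter. $N_d\ge1$ is the number of reflecting elements, $l_d=N_dE^2/\mathrm{Var}(M)$, $k_d=\mathrm{Var}(M)/E$. The sum of the $N_d$ gains is modelled by $\bar M_d$ with density $\frac{y^{l_d-1}}{\Gamma(l_d)k_d^{l_d}}e^{-y/k_d}$, $y>0$. The instantaneous SNR is $\gamma_d=\mu_{r,d}(\bar M_d/E)^r$, where $\mu_{r,d}>0$ is the electrical SNR and $r$ is the detection type ($r=1$ heterodyne, $r=2$ intensity modulation/direct detection). The pair $(p,q)$ encodes the modulation scheme. Constants: $\Lambda_{3,d}=\frac{E^{l_d}}{\Gamma(l_d)k_d^{l_d}(2\pi)^{(r-1)/2}}$, $\Lambda_{4,d}=\left[\frac{E}{k_dr}\right]^r$. *)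

theory Defs
  imports "HOL-Probability.Probability" "HOL-Complex_Analysis.Complex_Analysis"
begin

(* Parameter lists are indexed from 0, so a_(i+1) is as ! i; p' and q' are the list lengths.
   In the denominator, Gamma takes the value 0 at its poles and x / 0 = 0, which agrees with
   1/Gamma vanishing there. *)
definition meijer_integrand ::
    "nat \<Rightarrow> nat \<Rightarrow> complex list \<Rightarrow> complex list \<Rightarrow> complex \<Rightarrow> complex \<Rightarrow> complex" where
  "meijer_integrand m n as bs z s =
     ((\<Prod>i<m. Gamma (bs ! i + s)) * (\<Prod>i<n. Gamma (1 - as ! i - s))) /
     ((\<Prod>i=n..<length as. Gamma (as ! i + s)) * (\<Prod>i=m..<length bs. Gamma (1 - bs ! i - s)))
     * z powr (- s)"

(* A simple path from c - i*infinity to c + i*infinity: a vertical line that may be indented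
   in a bounded region. *)
definition upward_contour :: "(real \<Rightarrow> complex) \<Rightarrow> bool" where
  "upward_contour L \<longleftrightarrow>
     inj L \<and> L piecewise_C1_differentiable_on UNIV \<and>
     (\<exists>c T. \<forall>t. \<bar>t\<bar> \<ge> T \<longrightarrow> L t = Complex c t)"

(* The two sides of such a path are the components of its complement that contain
   the points far to the left and far to the right, respectively. *)
definition left_of_contour :: "(real \<Rightarrow> complex) \<Rightarrow> complex \<Rightarrow> bool" where
  "left_of_contour L s \<longleftrightarrow>
     (\<exists>w. (\<forall>t. Re w < Re (L t)) \<and> connected_component (- range L) s w)"

definition right_of_contour :: "(real \<Rightarrow> complex) \<Rightarrow> complex \<Rightarrow> bool" where
  "right_of_contour L s \<longleftrightarrow>
     (\<exists>w. (\<forall>t. Re (L t) < Re w) \<and> connected_component (- range L) s w)"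

definition meijer_contour ::
    "nat \<Rightarrow> nat \<Rightarrow> complex list \<Rightarrow> complex list \<Rightarrow> (real \<Rightarrow> complex) \<Rightarrow> bool" where
  "meijer_contour m n as bs L \<longleftrightarrow>
     upward_contour L \<and>
     (\<forall>i<m. \<forall>s. is_pole (\<lambda>s. Gamma (bs ! i + s)) s \<longrightarrow> left_of_contour L s) \<and>
     (\<forall>i<n. \<forall>s. is_pole (\<lambda>s. Gamma (1 - as ! i - s)) s \<longrightarrow> right_of_contour L s)"

(* The line integral is a Henstock-Kurzweil integral over the whole real line, hence also covers
   conditionally convergent contour integrals. *)
definition meijer_G ::
    "nat \<Rightarrow> nat \<Rightarrow> complex list \<Rightarrow> complex list \<Rightarrow> complex \<Rightarrow> complex" where
  "meijer_G m n as bs z =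
     (let L = (SOME L. meijer_contour m n as bs L)
      in 1 / (2 * of_real pi * \<i>) *
         integral UNIV (\<lambda>t. meijer_integrand m n as bs z (L t) * vector_derivative L (at t)))"

definition gamma_density :: "real \<Rightarrow> real \<Rightarrow> real \<Rightarrow> real" where
  "gamma_density l k y =
     (if y > 0 then y powr (l - 1) / (Gamma l * k powr l) * exp (- y / k) else 0)"

definition average_ber :: "real \<Rightarrow> real \<Rightarrow> (real \<Rightarrow> real) \<Rightarrow> real" where
  "average_ber p q F =
     q powr p / (2 * Gamma p) * (LBINT x:{0<..}. exp (- q * x) * x powr (p - 1) * F x)"

end

theory Submission
  imports Defs
begin

text \<open>
  Write \<open>\<beta> = l / r\<close>. By the duplication formula the integrand of the \<open>G\<close>-function is, up to a constant,
  \<open>\<Gamma>(r s) \<Gamma>(p + \<beta> - s) / (\<beta> - s) w\<^sup>-\<^sup>s\<close>. It decays faster than \<open>\<bar>Im s\<bar>\<^sup>-\<^sup>2\<close> in vertical strips, so every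
  admissible contour can be deformed into the line \<open>Re s = \<beta> / 2\<close>. On this line the two factors
  \<open>\<Gamma>(p + \<beta> - s) = \<integral> e\<^sup>-\<^sup>x x\<^bsup>p + \<beta> - s - 1\<^esup> dx\<close> and \<open>1 / (\<beta> - s) = \<integral> v\<^bsup>\<beta> - s - 1\<^esup> dv\<close> over \<open>0 < v < 1\<close> are expanded,
  the integrals are interchanged, and the Cahen--Mellin integral evaluates the inner one to
  \<open>exp (- (w x v)\<^bsup>1/r\<^esup>)\<close>. The \<open>v\<close>-integral is then the gamma distribution function after the
  substitution \<open>y = Y v\<^bsup>1/r\<^esup>\<close>, and the \<open>x\<close>-integral is the average bit error rate after rescaling by \<open>q\<close>.
\<close>

section \<open>Decay of the Gamma function in vertical strips\<close>

text \<open>\<open>meijer_G\<close> takes its contour from \<open>SOME\<close>, so nothing is known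
  about it beyond \<open>meijer_contour\<close>: it may wander across any vertical line, and its two
  sides are given only as components of the complement. Cauchy's theorem is therefore used in its
  winding number form, which asks neither for simplicity nor for an orientation of the closed curve.
  Moreover \<open>integral\<close> is 0 on functions that are not integrable, so convergence along
  the chosen contour has to be proved. Stirling's formula is avoided: quadratic decay, obtained from
  the functional equation, suffices for every limit and interchange. The factor 1 / (\<beta> - s) is
  Gamma(\<beta> - s) / Gamma(\<beta> + 1 - s), from the upper parameter 1 - \<beta> and the lower
  parameter -\<beta>. The Cahen-Mellin integral comes from Fourier inversion instead of an infinite
  residue sum, since Gamma on a vertical line is a Fourier transform.\<close>

lemma norm_Gamma_le_Gamma_Re:
  fixes z :: complex
  assumes "Re z > 0"
  shows "norm (Gamma z) \<le> Gamma (Re z)"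
proof -
  have a: "((\<lambda>t. complex_of_real t powr (z - 1) / of_real (exp t)) has_integral Gamma z) {0..}"
    by (rule Gamma_integral_complex) (use assms in auto)
  have b: "((\<lambda>t. t powr (Re z - 1) / exp t) has_integral Gamma (Re z)) {0..}"
    by (rule Gamma_integral_real) (use assms in auto)
  have "norm (integral {0..} (\<lambda>t. complex_of_real t powr (z - 1) / of_real (exp t)))
     \<le> integral {0..} (\<lambda>t. t powr (Re z - 1) / exp t)"
    by (rule integral_norm_bound_integral)
       (use a b in \<open>auto simp: has_integral_iff norm_divide norm_powr_real_powr\<close>)
  then show ?thesis
    using a b by (simp add: has_integral_iff)
qed

text \<open>By the functional equation Gamma(s) = Gamma(s + n) / (s (s + 1) ... (s + n - 1)). Each
  factor of the denominator has modulus at least |Im s|, and the numerator is bounded by the values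
  of Gamma on a compact interval of positive reals.\<close>

lemma Gamma_strip_decay:
  fixes a b :: real
  shows "\<exists>C\<ge>0. \<forall>s. a \<le> Re s \<and> Re s \<le> b \<and> \<bar>Im s\<bar> \<ge> 1 \<longrightarrow> norm (Gamma s) \<le> C / \<bar>Im s\<bar> ^ N"
proof -
  obtain n0 :: nat where "1 - a \<le> real n0"
    using real_arch_simple by blast
  \<comment> \<open>The shift has to move the strip into Re s \<ge> 1 and also to produce at least
    \<open>N\<close> factors of size |Im s|.\<close>
  define n where "n = max n0 N"
  have n: "n \<ge> N" "a + real n \<ge> 1"
    using \<open>1 - a \<le> real n0\<close> by (auto simp: n_def)
  have "compact (Gamma ` {a + real n..b + real n})"
    by (intro compact_continuous_image continuous_on_Gamma)
       (use n in \<open>auto elim!: nonpos_Ints_cases\<close>)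
  then obtain C where C: "\<And>x. x \<in> {a + real n..b + real n} \<Longrightarrow> \<bar>Gamma x\<bar> \<le> C" "C > 0"
    by (metis bounded_pos compact_imp_bounded imageI real_norm_def)
  show ?thesis
  proof (intro exI conjI allI impI)
    show "0 \<le> C" using C by simp
    fix s assume s: "a \<le> Re s \<and> Re s \<le> b \<and> \<bar>Im s\<bar> \<ge> 1"
    have ns: "s \<notin> \<int>\<^sub>\<le>\<^sub>0"
      using s by (auto elim!: nonpos_Ints_cases)
    have "norm (pochhammer s n) = (\<Prod>i<n. norm (s + of_nat i))"
      by (simp add: pochhammer_prod prod_norm atLeast0LessThan)
    also have "\<dots> \<ge> (\<Prod>i<n. \<bar>Im s\<bar>)"
    proof (rule prod_mono, safe)
      fix i show "\<bar>Im s\<bar> \<le> norm (s + of_nat i)"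
        using abs_Im_le_cmod[of "s + of_nat i"] by simp
    qed auto
    finally have p: "\<bar>Im s\<bar> ^ n \<le> norm (pochhammer s n)" by simp
    have q: "\<bar>Im s\<bar> ^ N \<le> \<bar>Im s\<bar> ^ n"
      by (rule power_increasing) (use n s in auto)
    have pos: "0 < \<bar>Im s\<bar> ^ N" using s by auto
    have "norm (Gamma (s + of_nat n)) \<le> Gamma (Re (s + of_nat n))"
      by (rule norm_Gamma_le_Gamma_Re) (use n s in auto)
    also have "\<dots> \<le> C" using C(1)[of "Re s + real n"] s by auto
    finally have "norm (Gamma (s + of_nat n)) \<le> C" .
    moreover have "norm (Gamma (s + of_nat n)) = norm (pochhammer s n) * norm (Gamma s)"
      using pochhammer_Gamma[OF ns, of n] ns by (simp add: norm_divide Gamma_eq_zero_iff)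
    ultimately have "norm (pochhammer s n) * norm (Gamma s) \<le> C" by simp
    moreover have "\<bar>Im s\<bar> ^ N * norm (Gamma s) \<le> norm (pochhammer s n) * norm (Gamma s)"
      by (rule mult_right_mono) (use p q in auto)
    ultimately show "norm (Gamma s) \<le> C / \<bar>Im s\<bar> ^ N"
      using pos by (simp add: pos_le_divide_eq mult.commute)
  qed
qed

section \<open>Deforming an upward contour into a vertical line\<close>

text \<open>Library paths are parametrised by [0, 1]. The offset is written \<open>+ - T\<close> so
  that facts about maps of the form \<open>m * x + c\<close> apply.\<close>

definition contour_segment :: "(real \<Rightarrow> complex) \<Rightarrow> real \<Rightarrow> real \<Rightarrow> complex" where
  "contour_segment L T = (\<lambda>u. L (2 * T * u + - T))"

text \<open>The curve may cross itself, since \<open>L\<close> is free to cross the line Re s = x,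
  and its orientation depends on the side of that line on which \<open>L\<close> ends. Only its
  winding numbers are used.\<close>

definition closed_contour :: "(real \<Rightarrow> complex) \<Rightarrow> real \<Rightarrow> real \<Rightarrow> real \<Rightarrow> complex" where
  "closed_contour L T x = contour_segment L T +++ linepath (L T) (Complex x T) +++
     linepath (Complex x T) (Complex x (- T)) +++ linepath (Complex x (- T)) (L (- T))"

lemma contour_segment_ends [simp]:
  "pathstart (contour_segment L T) = L (- T)" "pathfinish (contour_segment L T) = L T"
  by (simp_all add: contour_segment_def pathstart_def pathfinish_def)

lemma path_image_contour_segment: "path_image (contour_segment L T) \<subseteq> range L"
  by (auto simp: contour_segment_def path_image_def)

lemma affine_image_unit_interval:
  assumes "T > (0::real)" shows "(\<lambda>u. 2 * T * u + - T) ` {0..1} = {- T..T}"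
  using assms by (subst image_affinity_atLeastAtMost) auto

lemma valid_path_contour_segment:
  assumes "upward_contour L"
  shows "valid_path (contour_segment L T)"
proof -
  have "L piecewise_C1_differentiable_on UNIV"
    using assms by (simp add: upward_contour_def)
  then have "L piecewise_C1_differentiable_on ((\<lambda>u. 2 * T * u + - T) ` {0..1})"
    by (rule piecewise_C1_differentiable_on_subset) auto
  from piecewise_C1_differentiable_affine[OF this]
  show ?thesis by (simp add: valid_path_def contour_segment_def o_def)
qed

lemma piecewise_C1_imp_differentiable:
  assumes "L piecewise_C1_differentiable_on UNIV"
  obtains S where "finite S" "\<And>t. t \<notin> S \<Longrightarrow> L differentiable (at t)"
proof -
  obtain S where "finite S" "L C1_differentiable_on (UNIV - S)"
    using assms by (auto simp: piecewise_C1_differentiable_on_def)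
  then show ?thesis
    using that[of S] by (auto simp: C1_differentiable_on_eq)
qed

lemma has_contour_integral_contour_segment:
  assumes L: "upward_contour L" and T: "T > 0"
    and f: "(f has_contour_integral i) (contour_segment L T)"
  shows "((\<lambda>t. f (L t) * vector_derivative L (at t)) has_integral i) {- T..T}"
proof -
  obtain S where S: "finite S" "\<And>t. t \<notin> S \<Longrightarrow> L differentiable (at t)"
    using L piecewise_C1_imp_differentiable by (metis upward_contour_def)
  define h where "h = (\<lambda>t. f (L t) * vector_derivative L (at t))"
  define S' where "S' = (\<lambda>t. (t + T) / (2 * T)) ` S"
  have "((\<lambda>u. (2 * T) *\<^sub>R h (2 * T * u + - T)) has_integral i) {0..1}"
  \<comment> \<open>\<open>S'\<close> is the preimage of the corners of \<open>L\<close>. Off it the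
    chain rule for the affine reparametrisation holds, and finitely many points do not affect the
    integral.\<close>
  proof (rule has_integral_spike_finite[of S'])
    show "finite S'" using S by (simp add: S'_def)
    show "((\<lambda>u. f (contour_segment L T u) * vector_derivative (contour_segment L T) (at u))
            has_integral i) {0..1}"
      using f by (simp add: has_contour_integral)
    fix u assume u: "u \<in> {0..1} - S'"
    have "2 * T * u + - T \<notin> S"
    proof
      assume "2 * T * u + - T \<in> S"
      then have "(2 * T * u + - T + T) / (2 * T) \<in> S'" unfolding S'_def by (rule imageI)
      then show False using u T by simp
    qed
    then have "L differentiable (at (2 * T * u + - T))" by (rule S)
    then have "vector_derivative (L \<circ> (\<lambda>u. 2 * T * u + - T)) (at u) =
        vector_derivative (\<lambda>u. 2 * T * u + - T) (at u) *\<^sub>R vector_derivative L (at (2 * T * u + - T))"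
      by (intro vector_derivative_chain_at) auto
    also have "vector_derivative (\<lambda>u. 2 * T * u + - T) (at u) = 2 * T"
      by (intro vector_derivative_at) (auto intro!: derivative_eq_intros simp: has_real_derivative_iff_has_vector_derivative[symmetric])
    finally show "(2 * T) *\<^sub>R h (2 * T * u + - T) =
        f (contour_segment L T u) * vector_derivative (contour_segment L T) (at u)"
      by (simp add: contour_segment_def h_def o_def)
  qed
  then have "((\<lambda>u. (2 * T) *\<^sub>R h (2 * T * u + - T)) has_integral i) (cbox 0 1)" by simp
  from has_integral_affinity[OF this, of "1 / (2 * T)" "1 / 2"] T
  have "((\<lambda>t. (2 * T) *\<^sub>R h t) has_integral (2 * T) *\<^sub>R i)
      ((\<lambda>x. 2 * T * x + - T) ` {0..1})"
    by (simp add: algebra_simps)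
  then have "((\<lambda>t. (2 * T) *\<^sub>R h t) has_integral (2 * T) *\<^sub>R i) {- T..T}"
    unfolding affine_image_unit_interval[OF T] .
  from has_integral_cmul[OF this, of "1 / (2 * T)"] T show ?thesis
    by (simp add: h_def)
qed

lemma closed_contour_valid:
  assumes "upward_contour L"
  shows "valid_path (closed_contour L T x)"
    and "pathfinish (closed_contour L T x) = pathstart (closed_contour L T x)"
    and "path (closed_contour L T x)"
proof -
  show v: "valid_path (closed_contour L T x)"
    by (simp add: closed_contour_def valid_path_join valid_path_contour_segment assms)
  then show "path (closed_contour L T x)" by (rule valid_path_imp_path)
  show "pathfinish (closed_contour L T x) = pathstart (closed_contour L T x)"
    by (simp add: closed_contour_def)
qed

lemma closed_segment_horizontal:
  "z \<in> closed_segment (Complex a y) (Complex b y) \<Longrightarrow> Im z = y \<and> Re z \<in> closed_segment a b"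
  by (auto simp: closed_segment_def complex_eq_iff algebra_simps)

lemma closed_segment_vertical:
  "z \<in> closed_segment (Complex x a) (Complex x b) \<Longrightarrow> Re z = x \<and> Im z \<in> closed_segment a b"
  by (auto simp: closed_segment_def complex_eq_iff algebra_simps)

lemma path_image_closed_contour:
  assumes L: "L T = Complex c T" "L (- T) = Complex c (- T)" and z: "z \<in> path_image (closed_contour L T x)"
  shows "z \<in> L ` {- \<bar>T\<bar>..\<bar>T\<bar>} \<or> \<bar>Im z\<bar> = \<bar>T\<bar> \<and> Re z \<in> closed_segment c x \<or> Re z = x"
proof -
  have "path_image (contour_segment L T) \<subseteq> L ` {- \<bar>T\<bar>..\<bar>T\<bar>}"
  proof
    fix w assume "w \<in> path_image (contour_segment L T)"
    then obtain u where u: "u \<in> {0..1}" "w = L (2 * T * u + - T)"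
      by (auto simp: path_image_def contour_segment_def)
    have "\<bar>T * (2 * u - 1)\<bar> \<le> \<bar>T\<bar> * 1"
      unfolding abs_mult by (rule mult_left_mono) (use u in auto)
    then have "2 * T * u + - T \<in> {- \<bar>T\<bar>..\<bar>T\<bar>}" by (auto simp: algebra_simps)
    then show "w \<in> L ` {- \<bar>T\<bar>..\<bar>T\<bar>}" using u by blast
  qed
  with z L show ?thesis
    by (auto simp: closed_contour_def path_image_join closed_segment_commute
        dest!: closed_segment_horizontal closed_segment_vertical subsetD)
qed

text \<open>The range is a compact middle piece together with a closed part of a vertical line.
  Hence the complement is open and its connected components are path components, which supplies the
  path used for the winding numbers.\<close>

lemma upward_contour_closed_range:
  assumes "upward_contour L" and L: "\<And>t. \<bar>t\<bar> \<ge> T0 \<Longrightarrow> L t = Complex c t"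
  shows "closed (range L)"
proof -
  have cont: "continuous_on UNIV L"
    using assms(1) by (simp add: upward_contour_def piecewise_C1_differentiable_on_def)
  have "range L = L ` {- T0..T0} \<union> {z. Re z = c \<and> \<bar>Im z\<bar> \<ge> T0}"
  proof (intro equalityI subsetI)
    fix z assume "z \<in> range L"
    then obtain t where "z = L t" by blast
    then show "z \<in> L ` {- T0..T0} \<union> {z. Re z = c \<and> \<bar>Im z\<bar> \<ge> T0}"
      using L[of t] by (cases "\<bar>t\<bar> \<ge> T0") (auto simp: image_iff abs_le_iff intro!: bexI[of _ t])
  next
    fix z assume "z \<in> L ` {- T0..T0} \<union> {z. Re z = c \<and> \<bar>Im z\<bar> \<ge> T0}"
    moreover have "z \<in> range L" if "Re z = c" "\<bar>Im z\<bar> \<ge> T0"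
      using L[OF that(2)] that by (metis complex_surj rangeI)
    ultimately show "z \<in> range L" by auto
  qed
  moreover have "closed (L ` {- T0..T0})"
    by (intro compact_imp_closed compact_continuous_image continuous_on_subset[OF cont]) auto
  moreover have "closed {z. Re z = c \<and> \<bar>Im z\<bar> \<ge> T0}"
    by (intro closed_Collect_conj closed_Collect_eq closed_Collect_le continuous_intros)
  ultimately show ?thesis by auto
qed

text \<open>Pushing the vertical side of the closed contour towards \<open>\<sigma>\<infinity>\<close> never meets \<open>s\<close>; once it lies beyond
  a path from \<open>s\<close> to \<open>w\<close> avoiding \<open>L\<close>, that path carries the winding number of \<open>s\<close> to the point \<open>w\<close>,
  which lies outside.\<close>

lemma winding_number_closed_contour_eq_0:
  fixes \<sigma> x0 :: real
  assumes L: "upward_contour L" and LT: "\<And>t. \<bar>t\<bar> \<ge> T0 \<Longrightarrow> L t = Complex c t"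
    and \<sigma>: "\<sigma> = 1 \<or> \<sigma> = - 1" and s: "Im s = 0" "\<sigma> * Re s < \<sigma> * x0"
    and w: "\<And>t. \<sigma> * Re w < \<sigma> * Re (L t)" and sw: "connected_component (- range L) s w"
  shows "\<exists>T1. \<forall>T\<ge>T1. winding_number (closed_contour L T x0) s = 0"
proof -
  have "open (- range L)"
    using upward_contour_closed_range[OF L LT] by (simp add: open_Compl)
  then have "path_component (- range L) s w"
    using sw by (simp add: path_component_eq_connected_component open_imp_locally_path_connected)
  then obtain p where p: "path p" "path_image p \<subseteq> - range L" "pathstart p = s" "pathfinish p = w"
    by (auto simp: path_component_def)
  have "bounded (path_image p)" using p by (simp add: bounded_path_image)
  then obtain K where K: "\<And>z. z \<in> path_image p \<Longrightarrow> norm z \<le> K" "K > 0"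
    by (auto simp: bounded_pos)
  have ps: "s \<in> path_image p" "w \<in> path_image p" using p by auto
  \<comment> \<open>Beyond \<open>x0\<close>, beyond \<open>c\<close>, and beyond the disc of radius
    \<open>K\<close> that contains the path \<open>p\<close>, in the direction given by
    \<sigma>.\<close>
  define x1 where "x1 = \<sigma> * (\<bar>x0\<bar> + \<bar>c\<bar> + K + 1)"
  have x1: "\<bar>x1\<bar> = \<bar>x0\<bar> + \<bar>c\<bar> + K + 1" "\<sigma> * x0 \<le> \<sigma> * x1" "\<sigma> * x1 = \<bar>x1\<bar>"
    using \<sigma> K(2) by (auto simp: x1_def)
  show ?thesis
  proof (intro exI allI impI)
    \<comment> \<open>\<open>K + 1\<close> keeps the horizontal sides away from \<open>p\<close>;
      the bound 1 keeps them away from the real point \<open>s\<close>.\<close>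
    fix T assume T: "T \<ge> max (max T0 1) (K + 1)"
    have LT': "L T = Complex c T" "L (- T) = Complex c (- T)"
      using LT[of T] LT[of "- T"] T by auto
    have img: "z \<in> range L \<or> (\<bar>Im z\<bar> = T \<and> Re z \<in> closed_segment c x1) \<or> Re z = x1"
      if "z \<in> path_image (closed_contour L T x1)" for z
      using path_image_closed_contour[OF LT' that] T by auto
    have "winding_number (closed_contour L T x1) s = winding_number (closed_contour L T x0) s"
    proof (rule winding_number_loops_linear_eq)
      fix t :: real assume t: "t \<in> {0..1}"
      \<comment> \<open>The right-nested joins put the corners at 1/2, 3/4 and 7/8. Under the linear
        homotopy the first piece is fixed, the second and fourth stay at height T and -T, and the
        third sweeps from \<open>x0\<close> to \<open>x1\<close>, away from
        \<open>s\<close>.\<close>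
      consider "t \<le> 1/2" | "1/2 < t" "t \<le> 3/4" | "3/4 < t" "t \<le> 7/8" | "7/8 < t" by linarith
      then show "s \<notin> closed_segment (closed_contour L T x0 t) (closed_contour L T x1 t)"
      proof cases
        case 1
        then have "closed_contour L T x0 t = contour_segment L T (2 * t)"
          "closed_contour L T x1 t = contour_segment L T (2 * t)"
          by (auto simp: closed_contour_def joinpaths_def)
        then show ?thesis using ps(1) p(2) by (auto simp: contour_segment_def)
      next
        case 2
        then have "Im (closed_contour L T x0 t) = T" "Im (closed_contour L T x1 t) = T"
          using T by (auto simp: closed_contour_def joinpaths_def linepath_def LT' algebra_simps)
        then have "\<forall>z \<in> closed_segment (closed_contour L T x0 t) (closed_contour L T x1 t). Im z = T"
          by (metis closed_segment_horizontal complex_surj)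
        then show ?thesis using s T by auto
      next
        case 3
        then have "Re (closed_contour L T x0 t) = x0" "Re (closed_contour L T x1 t) = x1"
          using T by (auto simp: closed_contour_def joinpaths_def linepath_def LT' algebra_simps)
        then have "Re z \<in> closed_segment x0 x1"
          if "z \<in> closed_segment (closed_contour L T x0 t) (closed_contour L T x1 t)" for z
          using that by (auto simp: closed_segment_def)
        then have "\<sigma> * x0 \<le> \<sigma> * Re z"
          if "z \<in> closed_segment (closed_contour L T x0 t) (closed_contour L T x1 t)" for z
          using that x1(2) \<sigma> by (fastforce simp: closed_segment_eq_real_ivl split: if_splits)
        then show ?thesis using s by force
      next
        case 4
        then have "Im (closed_contour L T x0 t) = - T" "Im (closed_contour L T x1 t) = - T"
          using T by (auto simp: closed_contour_def joinpaths_def linepath_def LT' algebra_simps)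
        then have "\<forall>z \<in> closed_segment (closed_contour L T x0 t) (closed_contour L T x1 t). Im z = - T"
          by (metis closed_segment_horizontal complex_surj)
        then show ?thesis using s T by auto
      qed
    qed (use closed_contour_valid[OF L] in auto)
    moreover have "winding_number (closed_contour L T x1) s = winding_number (closed_contour L T x1) w"
    proof (rule winding_number_eq)
      show "connected (path_image p)" using p by (simp add: connected_path_image)
      show "path_image p \<inter> path_image (closed_contour L T x1) = {}"
      proof -
        have False if z: "z \<in> path_image p" "z \<in> path_image (closed_contour L T x1)" for z
        proof -
          have "\<bar>Re z\<bar> \<le> K" "\<bar>Im z\<bar> \<le> K"
            using K(1)[OF z(1)] abs_Re_le_cmod[of z] abs_Im_le_cmod[of z] by linarith+
          then show False using img[OF z(2)] z(1) p(2) T x1 by auto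
        qed
        then show ?thesis by blast
      qed
    qed (use closed_contour_valid[OF L] ps in auto)
    moreover have "winding_number (closed_contour L T x1) w = 0"
    proof (rule winding_number_zero_outside)
      \<comment> \<open>The half-plane strictly beyond \<open>w\<close> contains the whole curve but
        not \<open>w\<close> itself.\<close>
      show "convex {z. \<sigma> * Re w < \<sigma> * Re z}"
        using \<sigma> by (auto simp: convex_halfspace_Re_gt convex_halfspace_Re_lt)
      show "path_image (closed_contour L T x1) \<subseteq> {z. \<sigma> * Re w < \<sigma> * Re z}"
      proof
        fix z assume z: "z \<in> path_image (closed_contour L T x1)"
        have wc: "\<sigma> * Re w < \<sigma> * c" using w[of T] LT' by simp
        have "\<bar>Re w\<bar> \<le> K" using K(1)[OF ps(2)] abs_Re_le_cmod[of w] by linarith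
        then have wx: "\<sigma> * Re w < \<sigma> * x1" using x1 \<sigma> by auto
        consider "z \<in> range L" | "Re z \<in> closed_segment c x1" | "Re z = x1" using img[OF z] by blast
        then show "z \<in> {z. \<sigma> * Re w < \<sigma> * Re z}"
        proof cases
          case 2
          then show ?thesis using \<sigma> wc wx by (auto simp: closed_segment_eq_real_ivl split: if_splits)
        qed (use w wx in auto)
      qed
    qed (use closed_contour_valid[OF L] in auto)
    ultimately show "winding_number (closed_contour L T x0) s = 0" by simp
  qed
qed

text \<open>Symmetric truncations compute an integral that is already known to exist. This turns an
  estimate on \<open>{- T..T}\<close> into an equality of integrals over the line.\<close>

lemma has_integral_imp_symmetric_limit:
  fixes h :: "real \<Rightarrow> 'a::banach"
  assumes "(h has_integral I) UNIV"
  shows "(\<lambda>n. integral {- real n..real n} h) \<longlonglongrightarrow> I"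
proof (rule metric_LIMSEQ_I)
  fix e :: real assume "e > 0"
  then obtain B where B: "B > 0" "\<And>a b. ball 0 B \<subseteq> cbox a b \<Longrightarrow> norm (integral (cbox a b) h - I) < e"
    using assms[unfolded has_integral_alt'] by auto
  obtain N :: nat where N: "B \<le> real N" using real_arch_simple by blast
  show "\<exists>no. \<forall>n\<ge>no. dist (integral {- real n..real n} h) I < e"
  proof (intro exI allI impI)
    fix n assume "n \<ge> N"
    then have "ball 0 B \<subseteq> cbox (- real n) (real n)"
      using N by (auto simp: dist_real_def)
    from B(2)[OF this] show "dist (integral {- real n..real n} h) I < e"
      by (simp add: dist_norm)
  qed
qed

text \<open>\<open>P\<close> stands for the poles, possibly infinitely many in both directions.
  Since they are real, horizontal sides and vertical tails avoid them; since each strip contains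
  finitely many, a contour of bounded real part has to deal with finitely many only. The locale
  serves Gamma itself as well as the integrand of the G-function.\<close>

locale mellin_barnes_integrand =
  fixes f :: "complex \<Rightarrow> complex" and P :: "complex set"
  assumes holomorphic: "f holomorphic_on - P"
    and poles_real: "s \<in> P \<Longrightarrow> Im s = 0"
    and poles_finite: "finite {s \<in> P. \<bar>Re s\<bar> \<le> R}"
    and decay: "\<exists>C\<ge>0. \<forall>s. a \<le> Re s \<and> Re s \<le> b \<and> \<bar>Im s\<bar> \<ge> 1 \<longrightarrow> norm (f s) \<le> C / (Im s)\<^sup>2"
begin

text \<open>For |t| \<ge> 1 one has C / t^2 \<le> 2 C / (1 + t^2), and the latter is integrable on
  the whole line. Every abscissa \<open>c\<close> is allowed because the tail lies off the real
  axis.\<close>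

lemma vertical_tail_integrable:
  assumes T: "T \<ge> 1" and S: "S \<subseteq> {t. \<bar>t\<bar> \<ge> T}" "closed S"
  shows "(\<lambda>t. f (Complex c t)) absolutely_integrable_on S"
proof -
  obtain C where C: "C \<ge> 0" "\<And>t. \<bar>t\<bar> \<ge> 1 \<Longrightarrow> norm (f (Complex c t)) \<le> C / t\<^sup>2"
    using decay[of c c] by (metis complex.sel order_refl)
  have "continuous_on S (\<lambda>t. f (Complex c t))"
  proof (rule continuous_on_compose2[OF holomorphic_on_imp_continuous_on[OF holomorphic]])
    show "continuous_on S (Complex c)"
      by (simp add: Complex_eq) (intro continuous_intros)
    show "Complex c ` S \<subseteq> - P" using poles_real S T by fastforce
  qed
  then have meas: "(\<lambda>t. f (Complex c t)) \<in> borel_measurable (lebesgue_on S)"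
    by (intro continuous_imp_measurable_on_sets_lebesgue) (use S in auto)
  have "(\<lambda>t::real. inverse (1 + t\<^sup>2)) absolutely_integrable_on UNIV"
    using integrable_inverse_1_plus_square
    by (simp add: set_integrable_def integrable_completion)
  then have "(\<lambda>t::real. inverse (1 + t\<^sup>2)) absolutely_integrable_on S"
    by (rule set_integrable_subset) (use S in auto)
  then have gi: "(\<lambda>t. (2 * C) * inverse (1 + t\<^sup>2)) integrable_on S"
    by (intro integrable_on_mult_right set_lebesgue_integral_eq_integral(1))
  show ?thesis
  proof (rule measurable_bounded_by_integrable_imp_absolutely_integrable[OF meas _ gi])
    show "S \<in> sets lebesgue" using S by auto
    fix t assume "t \<in> S"
    then have t: "\<bar>t\<bar> \<ge> 1" using S T by force
    then have t2: "t\<^sup>2 \<ge> 1" using one_le_power[of "\<bar>t\<bar>" 2] by simp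
    have "C * (1 + t\<^sup>2) \<le> C * (2 * t\<^sup>2)" using C(1) t2 by (intro mult_left_mono) auto
    then have "C \<le> C * (2 * t\<^sup>2) / (1 + t\<^sup>2)"
      using t2 by (subst pos_le_divide_eq) auto
    then have "C \<le> (2 * C) * inverse (1 + t\<^sup>2) * t\<^sup>2"
      by (simp add: divide_inverse mult_ac)
    then have "C / t\<^sup>2 \<le> (2 * C) * inverse (1 + t\<^sup>2)"
      using t2 by (subst pos_divide_le_eq) auto
    with C(2)[OF t] show "norm (f (Complex c t)) \<le> (2 * C) * inverse (1 + t\<^sup>2)" by linarith
  qed
qed

lemma tails_integrable:
  fixes h :: "real \<Rightarrow> complex"
  assumes T: "T \<ge> 1" and h: "\<And>t. \<bar>t\<bar> > T \<Longrightarrow> h t = f (Complex c t) * \<i>"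
    and i: "h integrable_on {- T..T}"
  shows "h integrable_on UNIV"
proof -
  have "h integrable_on S" if "S = {..- T} \<or> S = {T..}" for S
  \<comment> \<open>The two end points are excluded because the contour may have a corner
    there.\<close>
  proof (rule integrable_spike[of "\<lambda>t. f (Complex c t) * \<i>" S "{- T, T}"])
    have "(\<lambda>t. f (Complex c t)) absolutely_integrable_on S"
      using T by (rule vertical_tail_integrable) (use T that in auto)
    then show "(\<lambda>t. f (Complex c t) * \<i>) integrable_on S"
      by (intro integrable_on_mult_left set_lebesgue_integral_eq_integral(1))
    show "h t = f (Complex c t) * \<i>" if "t \<in> S - {- T, T}" for t
      using that \<open>S = _ \<or> _\<close> T by (intro h) auto
  qed auto
  then have "h integrable_on {..- T}" "h integrable_on {T..}" by auto
  then have "h integrable_on ({..- T} \<union> {- T..T} \<union> {T..})"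
  proof (intro integrable_Un i)
    show "negligible ({..- T} \<inter> {- T..T})" "negligible (({..- T} \<union> {- T..T}) \<inter> {T..})"
      by (rule negligible_subset[of "{- T, T}"]; use T in force)+
  qed
  moreover have "{..- T} \<union> {- T..T} \<union> {T..} = UNIV" using T by auto
  ultimately show ?thesis by simp
qed

lemma vertical_integrable:
  assumes "\<And>s. s \<in> P \<Longrightarrow> Re s \<noteq> c"
  shows "(\<lambda>t. f (Complex c t)) absolutely_integrable_on UNIV"
proof -
  have "continuous_on {-1..1} (\<lambda>t. f (Complex c t))"
  proof (rule continuous_on_compose2[OF holomorphic_on_imp_continuous_on[OF holomorphic]])
    show "continuous_on {-1..1} (Complex c)"
      by (simp add: Complex_eq) (intro continuous_intros)
    show "Complex c ` {-1..1} \<subseteq> - P" using assms by fastforce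
  qed
  then have "(\<lambda>t. f (Complex c t)) absolutely_integrable_on {-1..1}"
    using absolutely_integrable_continuous_real by blast
  then have "(\<lambda>t. f (Complex c t)) absolutely_integrable_on ({..-1} \<union> {-1..1} \<union> {1..})"
    by (intro absolutely_integrable_Un vertical_tail_integrable[of 1 "{..-1}"]
        vertical_tail_integrable[of 1 "{1..}"]) auto
  moreover have "{..-1} \<union> {-1..1} \<union> {1..} = (UNIV :: real set)" by auto
  ultimately show ?thesis by simp
qed

text \<open>Cauchy's theorem on the closed contour through \<open>c \<plusminus> \<i>T\<close>, \<open>x0 \<plusminus> \<i>T\<close>; the horizontal sides are
  \<open>O(1/T\<^sup>2)\<close>.\<close>

lemma contour_integral_diff_bound:
  assumes L: "upward_contour L" and LT: "\<And>t. \<bar>t\<bar> \<ge> T0 \<Longrightarrow> L t = Complex c t"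
    and sep: "\<And>s. s \<in> P \<Longrightarrow>
      Re s < x0 \<and> left_of_contour L s \<or> x0 < Re s \<and> right_of_contour L s"
  shows "\<exists>C T1. \<forall>T\<ge>T1. (\<lambda>t. f (L t) * vector_derivative L (at t)) integrable_on {- T..T} \<and>
     norm (integral {- T..T} (\<lambda>t. f (L t) * vector_derivative L (at t)) -
           integral {- T..T} (\<lambda>t. f (Complex x0 t) * \<i>)) \<le> C / T\<^sup>2"
proof -
  have cont: "continuous_on UNIV L"
    using L by (simp add: upward_contour_def piecewise_C1_differentiable_on_def)
  have disj: "range L \<inter> P = {}"
  proof -
    have "s \<notin> range L" if "s \<in> P" for s
      using sep[OF that] by (auto simp: left_of_contour_def right_of_contour_def dest: connected_component_in)
    then show ?thesis by auto
  qed
  have "bounded ((\<lambda>t. Re (L t)) ` {- \<bar>T0\<bar>..\<bar>T0\<bar>})"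
    by (intro compact_imp_bounded compact_continuous_image continuous_intros continuous_on_subset[OF cont]) auto
  then obtain R0 where R0: "\<And>t. \<bar>t\<bar> \<le> \<bar>T0\<bar> \<Longrightarrow> \<bar>Re (L t)\<bar> \<le> R0"
    unfolding bounded_iff by (metis abs_le_D1 abs_le_D2 atLeastAtMost_iff image_eqI minus_le_iff real_norm_def)
  define R where "R = max R0 (max \<bar>c\<bar> \<bar>x0\<bar>) + 1"
  have R: "\<bar>Re (L t)\<bar> < R" for t
  proof (cases "\<bar>t\<bar> \<le> \<bar>T0\<bar>")
    case True then show ?thesis using R0[of t] by (auto simp: R_def)
  next
    case False then show ?thesis using LT[of t] by (auto simp: R_def)
  qed
  \<comment> \<open>The thresholds obtained below depend on the pole and need not be bounded over
    all of \<open>P\<close>. Only poles in a strip around \<open>L\<close> require them, and these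
    are finitely many; a pole outside the strip has winding number 0 by convexity.\<close>
  define F where "F = {s \<in> P. \<bar>Re s\<bar> \<le> R}"
  have "finite F" unfolding F_def by (rule poles_finite)
  have "\<exists>T1. \<forall>T\<ge>T1. winding_number (closed_contour L T x0) s = 0" if sP: "s \<in> P" for s
  proof -
    consider "Re s < x0" "left_of_contour L s" | "x0 < Re s" "right_of_contour L s"
      using sep[OF sP] by blast
    then show ?thesis
    proof cases
      case 1
      then obtain w where "\<forall>t. Re w < Re (L t)" "connected_component (- range L) s w"
        by (auto simp: left_of_contour_def)
      then show ?thesis
        using 1 poles_real[OF sP]
        by (intro winding_number_closed_contour_eq_0[OF L LT, where \<sigma> = 1 and w = w]) auto
    next
      case 2
      then obtain w where "\<forall>t. Re (L t) < Re w" "connected_component (- range L) s w"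
        by (auto simp: right_of_contour_def)
      then show ?thesis
        using 2 poles_real[OF sP]
        by (intro winding_number_closed_contour_eq_0[OF L LT, where \<sigma> = "-1" and w = w]) auto
    qed
  qed
  then obtain T1 where T1: "\<And>s T. s \<in> P \<Longrightarrow> T \<ge> T1 s \<Longrightarrow> winding_number (closed_contour L T x0) s = 0"
    by metis
  define T2 where "T2 = max (max T0 1) (Max (insert 0 (T1 ` F)))"
  have T2: "T1 s \<le> T2" if "s \<in> F" for s
    using that \<open>finite F\<close> by (auto simp: T2_def le_max_iff_disj)
  obtain C where C: "C \<ge> 0" "\<And>s. - R \<le> Re s \<Longrightarrow> Re s \<le> R \<Longrightarrow> \<bar>Im s\<bar> \<ge> 1 \<Longrightarrow> norm (f s) \<le> C / (Im s)\<^sup>2"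
    using decay[of "- R" R] by metis
  define h where "h = (\<lambda>t. f (L t) * vector_derivative L (at t))"
  have "h integrable_on {- T..T} \<and>
     norm (integral {- T..T} h - integral {- T..T} (\<lambda>t. f (Complex x0 t) * \<i>))
       \<le> (2 * C * \<bar>x0 - c\<bar>) / T\<^sup>2" if T: "T \<ge> T2" for T
  proof -
    have T': "T \<ge> T0" "T \<ge> 1" using T by (auto simp: T2_def)
    then have LT': "L T = Complex c T" "L (- T) = Complex c (- T)" using LT[of T] LT[of "- T"] by auto
    \<comment> \<open>An open set on which \<open>f\<close> is holomorphic and which contains the
      closed contour.\<close>
    define S where "S = {s. \<bar>Re s\<bar> < R} - F"
    have "open S"
      unfolding S_def using \<open>finite F\<close>
      by (intro open_Diff finite_imp_closed open_Collect_less continuous_intros) auto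
    have holS: "f holomorphic_on S"
      by (rule holomorphic_on_subset[OF holomorphic]) (auto simp: S_def F_def)
    have hp: "f contour_integrable_on (linepath a b)" if "closed_segment a b \<subseteq> S" for a b
      by (rule contour_integrable_holomorphic_simple[OF holS \<open>open S\<close>]) (use that in auto)
    have seg: "closed_segment a b \<subseteq> S"
      if "Re a \<in> {c, x0}" "Re b \<in> {c, x0}"
        "\<bar>Im a\<bar> = T \<and> Im b = Im a \<or> Re a = x0 \<and> Re b = x0" for a b
    proof
      fix z assume z: "z \<in> closed_segment a b"
      have cv: "convex {s. \<bar>Re s\<bar> < R}"
      proof -
        have "{s. \<bar>Re s\<bar> < R} = {s. Re s < R} \<inter> {s. Re s > - R}" by auto
        then show ?thesis by (simp add: convex_Int convex_halfspace_Re_lt convex_halfspace_Re_gt)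
      qed
      have "a \<in> {s. \<bar>Re s\<bar> < R}" "b \<in> {s. \<bar>Re s\<bar> < R}"
        using that by (auto simp: R_def)
      then have "\<bar>Re z\<bar> < R"
        using closed_segment_subset[OF _ _ cv] z by blast
      moreover have "z \<notin> F"
      proof
        assume "z \<in> F"
        then have zP: "z \<in> P" "Im z = 0" using poles_real by (auto simp: F_def)
        then have "Re z \<noteq> x0" using sep by force
        then show False
          using that(3) z zP(2) T' closed_segment_horizontal[of z "Re a" "Im a" "Re b"]
            closed_segment_vertical[of z x0 "Im a" "Im b"]
          by (metis abs_0 complex_surj not_one_le_zero)
      qed
      ultimately show "z \<in> S" by (simp add: S_def)
    qed
    define l1 where "l1 = linepath (Complex c T) (Complex x0 T)"
    define l2 where "l2 = linepath (Complex x0 T) (Complex x0 (- T))"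
    define l3 where "l3 = linepath (Complex x0 (- T)) (Complex c (- T))"
    have ints: "f contour_integrable_on l1" "f contour_integrable_on l2" "f contour_integrable_on l3"
      unfolding l1_def l2_def l3_def using T' by (intro hp seg; auto)+
    have segs: "path_image l1 \<subseteq> S" "path_image l2 \<subseteq> S" "path_image l3 \<subseteq> S"
      unfolding l1_def l2_def l3_def path_image_linepath using T' by (intro seg; auto)+
    have segL: "path_image (contour_segment L T) \<subseteq> S"
      using path_image_contour_segment[of L T] disj R by (auto simp: S_def F_def dest!: subsetD)
    have intL: "f contour_integrable_on (contour_segment L T)"
      by (rule contour_integrable_holomorphic_simple[OF holS \<open>open S\<close> _ segL])
         (rule valid_path_contour_segment[OF L])
    have cc: "closed_contour L T x0 = contour_segment L T +++ l1 +++ l2 +++ l3"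
      by (simp add: closed_contour_def l1_def l2_def l3_def LT')
    have "(f has_contour_integral 0) (closed_contour L T x0)"
    proof (rule Cauchy_theorem_global[OF \<open>open S\<close> holS])
      show sub: "path_image (closed_contour L T x0) \<subseteq> S"
        unfolding cc using segs segL
        by (intro subset_path_image_join) auto
      \<comment> \<open>The points outside \<open>S\<close> are the poles in the strip, covered by
        the choice of \<open>T2\<close>, and the points outside the open strip, which is convex and
        contains the curve.\<close>
      fix w assume "w \<notin> S"
      then consider "w \<in> F" | "\<bar>Re w\<bar> \<ge> R" by (auto simp: S_def)
      then show "winding_number (closed_contour L T x0) w = 0"
      proof cases
        case 1
        then show ?thesis using T1[of w T] T2[of w] T by (auto simp: F_def)
      next
        case 2
        show ?thesis
        proof (rule winding_number_zero_outside)
          have "{s. \<bar>Re s\<bar> < R} = {s. Re s < R} \<inter> {s. Re s > - R}" by auto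
          then show "convex {s. \<bar>Re s\<bar> < R}"
            by (simp add: convex_Int convex_halfspace_Re_lt convex_halfspace_Re_gt)
          show "path_image (closed_contour L T x0) \<subseteq> {s. \<bar>Re s\<bar> < R}"
            using sub by (auto simp: S_def)
        qed (use 2 closed_contour_valid[OF L] in auto)
      qed
    qed (use closed_contour_valid[OF L] in auto)
    then have "contour_integral (closed_contour L T x0) f = 0" by (rule contour_integral_unique)
    moreover have "contour_integral (closed_contour L T x0) f = contour_integral (contour_segment L T) f
        + (contour_integral l1 f + (contour_integral l2 f + contour_integral l3 f))"
      unfolding cc using ints intL valid_path_contour_segment[OF L]
      by (simp add: l1_def l2_def l3_def valid_path_join LT' contour_integrable_joinI)
    moreover have hL: "(h has_integral contour_integral (contour_segment L T) f) {- T..T}"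
      unfolding h_def using T' has_contour_integral_integral[OF intL]
      by (intro has_contour_integral_contour_segment[OF L]) auto
    \<comment> \<open>\<open>l2\<close> runs downwards, hence the sign; the factor \<i> is the
      derivative of the upward parametrisation.\<close>
    moreover have "contour_integral l2 f = - integral {- T..T} (\<lambda>t. f (Complex x0 t) * \<i>)"
    proof -
      have "(f has_contour_integral - contour_integral l2 f) (reversepath l2)"
        using has_contour_integral_integral[OF ints(2)]
        by (intro has_contour_integral_reversepath) (auto simp: l2_def)
      then have "(f has_contour_integral - contour_integral l2 f) (linepath (Complex x0 (- T)) (Complex x0 T))"
        by (simp add: l2_def)
      then have "((\<lambda>t. f (Complex x0 t)) has_integral - \<i> * - contour_integral l2 f) {- T..T}"
        using T' by (subst (asm) has_contour_integral_linepath_same_Re_iff[where c = x0 and a = "- T" and b = T]) auto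
      from has_integral_mult_left[OF this, of \<i>]
      have "((\<lambda>t. f (Complex x0 t) * \<i>) has_integral - contour_integral l2 f) {- T..T}"
        by (simp add: algebra_simps)
      then have "integral {- T..T} (\<lambda>t. f (Complex x0 t) * \<i>) = - contour_integral l2 f"
        by (rule integral_unique)
      then show ?thesis by (metis minus_minus)
    qed
    ultimately have "integral {- T..T} h - integral {- T..T} (\<lambda>t. f (Complex x0 t) * \<i>)
        = - (contour_integral l1 f + contour_integral l3 f)"
      by (simp add: integral_unique algebra_simps add_eq_0_iff)
    moreover have "norm (contour_integral l1 f) \<le> C / T\<^sup>2 * norm (Complex x0 T - Complex c T)"
      unfolding l1_def
    proof (rule contour_integral_bound_linepath)
      fix z assume z: "z \<in> closed_segment (Complex c T) (Complex x0 T)"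
      then have "z \<in> S" using segs(1) by (auto simp: l1_def)
      then show "norm (f z) \<le> C / T\<^sup>2"
        using C(2)[of z] closed_segment_horizontal[OF z] T' by (auto simp: S_def)
    qed (use ints C in \<open>auto simp: l1_def\<close>)
    moreover have "norm (contour_integral l3 f) \<le> C / T\<^sup>2 * norm (Complex c (- T) - Complex x0 (- T))"
      unfolding l3_def
    proof (rule contour_integral_bound_linepath)
      fix z assume z: "z \<in> closed_segment (Complex x0 (- T)) (Complex c (- T))"
      then have "z \<in> S" using segs(3) by (auto simp: l3_def)
      then show "norm (f z) \<le> C / T\<^sup>2"
        using C(2)[of z] closed_segment_horizontal[OF z] T' by (auto simp: S_def)
    qed (use ints C in \<open>auto simp: l3_def\<close>)
    moreover have "norm (Complex x0 T - Complex c T) = \<bar>x0 - c\<bar>"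
      "norm (Complex c (- T) - Complex x0 (- T)) = \<bar>x0 - c\<bar>"
      by (auto simp: cmod_def minus_complex.simps abs_minus_commute)
    ultimately have "norm (integral {- T..T} h - integral {- T..T} (\<lambda>t. f (Complex x0 t) * \<i>))
       \<le> C / T\<^sup>2 * \<bar>x0 - c\<bar> + C / T\<^sup>2 * \<bar>x0 - c\<bar>"
      by (metis (no_types, lifting) add_mono norm_minus_cancel norm_triangle_mono)
    then show ?thesis using hL by (auto simp: algebra_simps)
  qed
  then show ?thesis unfolding h_def by blast
qed

text \<open>The preceding bound compares truncations only. Both improper integrals are first shown
  to exist, the one over \<open>L\<close> by its vertical tails; then the difference of the
  truncations, being O(1/T^2), forces them to agree.\<close>

theorem contour_integral_eq_vertical_integral:
  assumes L: "upward_contour L"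
    and sep: "\<And>s. s \<in> P \<Longrightarrow>
      Re s < x0 \<and> left_of_contour L s \<or> x0 < Re s \<and> right_of_contour L s"
  shows "integral UNIV (\<lambda>t. f (L t) * vector_derivative L (at t)) =
         \<i> * integral UNIV (\<lambda>t. f (Complex x0 t))"
proof -
  obtain c T0 where LT: "\<And>t. \<bar>t\<bar> \<ge> T0 \<Longrightarrow> L t = Complex c t"
    using L by (auto simp: upward_contour_def)
  define h where "h = (\<lambda>t. f (L t) * vector_derivative L (at t))"
  define g where "g = (\<lambda>t. f (Complex x0 t) * \<i>)"
  obtain C T1 where CT: "\<And>T. T \<ge> T1 \<Longrightarrow> h integrable_on {- T..T}"
     "\<And>T. T \<ge> T1 \<Longrightarrow> norm (integral {- T..T} h - integral {- T..T} g) \<le> C / T\<^sup>2"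
    using contour_integral_diff_bound[OF L LT sep] unfolding h_def g_def by blast
  define T where "T = max (max T0 T1) 1"
  have "h integrable_on UNIV"
  proof (rule tails_integrable)
    show "h integrable_on {- T..T}" by (rule CT) (simp add: T_def)
    fix t assume t: "\<bar>t\<bar> > T"
    have "(L has_vector_derivative \<i>) (at t)"
    \<comment> \<open>The strict inequality gives an open set on which \<open>L\<close> is the
      vertical line.\<close>
    proof (rule has_vector_derivative_transform_within_open[of "Complex c" _ _ "{t. \<bar>t\<bar> > T}"])
      have "((\<lambda>t. of_real c + \<i> * of_real t) has_vector_derivative \<i>) (at t)"
        by (auto intro!: derivative_eq_intros)
      then show "(Complex c has_vector_derivative \<i>) (at t)"
        by (simp add: Complex_eq[abs_def])
      show "open {t. \<bar>t\<bar> > T}" by (intro open_Collect_less continuous_intros)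
    qed (use t LT in \<open>auto simp: T_def\<close>)
    then show "h t = f (Complex c t) * \<i>"
      using t LT[of t] by (simp add: h_def vector_derivative_at T_def)
  qed (auto simp: T_def)
  moreover have "g integrable_on UNIV"
    unfolding g_def
    by (intro integrable_on_mult_left set_lebesgue_integral_eq_integral(1) vertical_integrable)
       (use sep in force)
  ultimately have lim: "(\<lambda>n. integral {- real n..real n} h - integral {- real n..real n} g)
      \<longlonglongrightarrow> integral UNIV h - integral UNIV g"
    by (intro tendsto_diff has_integral_imp_symmetric_limit integrable_integral)
  have "(\<lambda>n. integral {- real n..real n} h - integral {- real n..real n} g) \<longlonglongrightarrow> 0"
  proof (rule Lim_null_comparison)
    show "\<forall>\<^sub>F n in sequentially. norm (integral {- real n..real n} h - integral {- real n..real n} g) \<le> C / (real n)\<^sup>2"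
      using eventually_ge_at_top[of "nat \<lceil>T1\<rceil>"]
      by eventually_elim (intro CT, linarith)
    show "(\<lambda>n. C / (real n)\<^sup>2) \<longlonglongrightarrow> 0"
      by (intro tendsto_divide_0[OF tendsto_const] filterlim_at_top_imp_at_infinity filterlim_pow_at_top filterlim_real_sequentially) auto
  qed
  from LIMSEQ_unique[OF lim this] have "integral UNIV h = integral UNIV g" by simp
  then show ?thesis by (simp add: h_def g_def mult.commute)
qed

end

section \<open>Fourier inversion and the Cahen--Mellin integral\<close>

text \<open>All three interchanges below (damped Fourier inversion and the expansions of 1 /
  (\<beta> - s) and of Gamma) admit a majorant that is a product of one-variable functions.\<close>

lemma lborel_Fubini_dominated:
  fixes F :: "real \<Rightarrow> real \<Rightarrow> complex" and g h :: "real \<Rightarrow> real"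
  assumes F [measurable]: "case_prod F \<in> borel_measurable (lborel \<Otimes>\<^sub>M lborel)"
    and g: "integrable lborel g" and h: "integrable lborel h"
    and le: "\<And>x y. norm (F x y) \<le> g x * h y"
  shows "(\<integral>x. (\<integral>y. F x y \<partial>lborel) \<partial>lborel) = (\<integral>y. (\<integral>x. F x y \<partial>lborel) \<partial>lborel)"
proof -
  have gh [measurable]: "g \<in> borel_measurable borel" "h \<in> borel_measurable borel"
    using g h by (auto dest: borel_measurable_integrable)
  have "integrable (lborel \<Otimes>\<^sub>M lborel) (\<lambda>(x, y). g x * h y)"
  proof (rule lborel_pair.Fubini_integrable)
    show "integrable lborel (\<lambda>x. \<integral>y. norm (case (x, y) of (x, y) \<Rightarrow> g x * h y) \<partial>lborel)"
      using g h by (simp add: abs_mult)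
    show "AE x in lborel. integrable lborel (\<lambda>y. case (x, y) of (x, y) \<Rightarrow> g x * h y)"
      using h by simp
  qed measurable
  then have "integrable (lborel \<Otimes>\<^sub>M lborel) (case_prod F)"
    by (rule Bochner_Integration.integrable_bound)
       (use order_trans[OF le abs_ge_self] in \<open>auto simp: split_beta\<close>)
  from lborel_pair.Fubini_integral[OF this] show ?thesis by simp
qed

text \<open>The characteristic function of the standard normal law, rescaled by s = e t. The
  right-hand side is 2 pi times the normal density of standard deviation \<open>e\<close> at
  \<open>u\<close>, an approximate identity as \<open>e\<close> tends to 0.\<close>

lemma gaussian_fourier_transform:
  assumes "e > 0"
  shows "(\<integral>t. exp (\<i> * of_real (u * t)) * of_real (exp (- (e * t)\<^sup>2 / 2)) \<partial>lborel) =
         of_real (2 * pi / e * std_normal_density (u / e))"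
proof -
  have "complex_of_real (exp (- (u / e)\<^sup>2 / 2)) = char std_normal_distribution (u / e)"
    by (simp add: char_std_normal_distribution)
  also have "\<dots> = (\<integral>s. std_normal_density s *\<^sub>R exp (\<i> * of_real (u / e * s)) \<partial>lborel)"
    unfolding char_def by (subst integral_density) (auto simp: normal_density_nonneg)
  also have "\<dots> = \<bar>e\<bar> *\<^sub>R (\<integral>t. std_normal_density (0 + e * t) *\<^sub>R exp (\<i> * of_real (u / e * (0 + e * t))) \<partial>lborel)"
    by (rule lborel_integral_real_affine) (use assms in auto)
  also have "(\<lambda>t. std_normal_density (0 + e * t) *\<^sub>R exp (\<i> * of_real (u / e * (0 + e * t)))) =
      (\<lambda>t. (1 / sqrt (2 * pi)) *\<^sub>R (exp (\<i> * of_real (u * t)) * of_real (exp (- (e * t)\<^sup>2 / 2))))"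
    using assms by (auto simp: normal_density_def scaleR_conv_of_real)
  finally have *: "complex_of_real (exp (- (u / e)\<^sup>2 / 2)) =
     (e / sqrt (2 * pi)) *\<^sub>R (\<integral>t. exp (\<i> * of_real (u * t)) * of_real (exp (- (e * t)\<^sup>2 / 2)) \<partial>lborel)"
    using assms by simp
  have "of_real (2 * pi / e * std_normal_density (u / e)) =
      (sqrt (2 * pi) / e) *\<^sub>R complex_of_real (exp (- (u / e)\<^sup>2 / 2))"
    using assms by (simp add: normal_density_def scaleR_conv_of_real field_simps flip: of_real_mult)
  then show ?thesis unfolding * using assms by simp
qed

text \<open>Damping the integrand by \<open>exp (- (\<epsilon> t)\<^sup>2 / 2)\<close> turns the inverse transform into the
  expectation of \<open>f (x + \<epsilon> Z)\<close> for a standard normal \<open>Z\<close>; now let \<open>\<epsilon> \<rightarrow> 0\<close>.\<close>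

theorem fourier_inversion:
  fixes f :: "real \<Rightarrow> complex"
  defines "\<phi> \<equiv> \<lambda>t. \<integral>y. f y * exp (\<i> * of_real (t * y)) \<partial>lborel"
  assumes cont: "continuous_on UNIV f" and bdd: "\<And>y. norm (f y) \<le> B"
    and f: "integrable lborel f" and \<phi>: "integrable lborel \<phi>"
  shows "(\<integral>t. \<phi> t * exp (- (\<i> * of_real (t * x))) \<partial>lborel) = 2 * of_real pi * f x"
proof (rule LIMSEQ_unique)
  have [measurable]: "f \<in> borel_measurable borel" "\<phi> \<in> borel_measurable borel"
    using f \<phi> by (auto dest: borel_measurable_integrable)
  define e where "e n = 1 / real (Suc n)" for n
  have e: "e n > 0" for n by (simp add: e_def)
  have e0: "e \<longlonglongrightarrow> 0" unfolding e_def[abs_def] using LIMSEQ_inverse_real_of_nat by (simp add: inverse_eq_divide)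
  define J where "J n = (\<integral>t. \<phi> t * exp (- (\<i> * of_real (t * x))) * of_real (exp (- (e n * t)\<^sup>2 / 2)) \<partial>lborel)" for n
  show "J \<longlonglongrightarrow> (\<integral>t. \<phi> t * exp (- (\<i> * of_real (t * x))) \<partial>lborel)"
    unfolding J_def
  proof (rule integral_dominated_convergence[where w = "\<lambda>t. norm (\<phi> t)"])
    show "AE t in lborel. (\<lambda>n. \<phi> t * exp (- (\<i> * of_real (t * x))) * of_real (exp (- (e n * t)\<^sup>2 / 2)))
      \<longlonglongrightarrow> \<phi> t * exp (- (\<i> * of_real (t * x)))"
    proof (rule AE_I2)
      fix t
      have "(\<lambda>n. \<phi> t * exp (- (\<i> * of_real (t * x))) * of_real (exp (- (e n * t)\<^sup>2 / 2)))
        \<longlonglongrightarrow> \<phi> t * exp (- (\<i> * of_real (t * x))) * of_real (exp (- (0 * t)\<^sup>2 / 2))"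
        by (intro tendsto_intros e0) auto
      then show "(\<lambda>n. \<phi> t * exp (- (\<i> * of_real (t * x))) * of_real (exp (- (e n * t)\<^sup>2 / 2)))
        \<longlonglongrightarrow> \<phi> t * exp (- (\<i> * of_real (t * x)))" by simp
    qed
    show "AE t in lborel. norm (\<phi> t * exp (- (\<i> * of_real (t * x))) * of_real (exp (- (e n * t)\<^sup>2 / 2)))
        \<le> norm (\<phi> t)" for n
      by (auto simp: norm_mult mult_left_le)
  qed (use \<phi> in auto)
  have J: "J n = (\<integral>z. 2 * of_real pi * (f (x + e n * z) * of_real (std_normal_density z)) \<partial>lborel)" for n
  proof -
    \<comment> \<open>The two phases are merged, so that the t-integral is the Gaussian transform at
      u = y - x.\<close>
    define F where "F = (\<lambda>y t. f y * (exp (\<i> * of_real ((y - x) * t)) * of_real (exp (- (e n * t)\<^sup>2 / 2))))"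
    have "J n = (\<integral>t. (\<integral>y. F y t \<partial>lborel) \<partial>lborel)"
      unfolding J_def
    proof (rule Bochner_Integration.integral_cong)
      fix t
      have "(\<integral>y. F y t \<partial>lborel) = (\<integral>y. f y * exp (\<i> * of_real (t * y)) *
          (exp (- (\<i> * of_real (t * x))) * of_real (exp (- (e n * t)\<^sup>2 / 2))) \<partial>lborel)"
        unfolding F_def by (intro Bochner_Integration.integral_cong) (auto simp: algebra_simps exp_diff exp_minus field_simps)
      also have "\<dots> = \<phi> t * exp (- (\<i> * of_real (t * x))) * of_real (exp (- (e n * t)\<^sup>2 / 2))"
        unfolding \<phi>_def by simp
      finally show "\<phi> t * exp (- (\<i> * of_real (t * x))) * of_real (exp (- (e n * t)\<^sup>2 / 2)) = (\<integral>y. F y t \<partial>lborel)" ..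
    qed simp
    also have "\<dots> = (\<integral>y. (\<integral>t. F y t \<partial>lborel) \<partial>lborel)"
    proof (rule lborel_Fubini_dominated[symmetric])
      show "case_prod F \<in> borel_measurable (lborel \<Otimes>\<^sub>M lborel)"
        unfolding F_def by measurable
      show "integrable lborel (\<lambda>y. norm (f y))" using f by simp
      have "integrable lborel (\<lambda>t. std_normal_density (0 + e n * t))"
        by (rule lborel_integrable_real_affine) (use e[of n] in auto)
      then have "integrable lborel (\<lambda>t. sqrt (2 * pi) * std_normal_density (0 + e n * t))" by simp
      then show "integrable lborel (\<lambda>t. exp (- (e n * t)\<^sup>2 / 2))"
        by (simp add: normal_density_def)
      show "norm (F y t) \<le> norm (f y) * exp (- (e n * t)\<^sup>2 / 2)" for y t
        by (simp add: F_def norm_mult)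
    qed
    also have "\<dots> = (\<integral>y. f y * of_real (2 * pi / e n * std_normal_density ((y - x) / e n)) \<partial>lborel)"
      unfolding F_def by (simp only: integral_mult_right_zero gaussian_fourier_transform[OF e[of n]])
    \<comment> \<open>With y = x + \<open>e n\<close> z the density no longer depends on
      \<open>n\<close>; only the argument of \<open>f\<close> does.\<close>
    also have "\<dots> = \<bar>e n\<bar> *\<^sub>R (\<integral>z. f (x + e n * z) * of_real (2 * pi / e n * std_normal_density ((x + e n * z - x) / e n)) \<partial>lborel)"
      by (rule lborel_integral_real_affine) (use e[of n] in auto)
    also have "\<dots> = (\<integral>z. e n *\<^sub>R (f (x + e n * z) * of_real (2 * pi / e n * std_normal_density ((x + e n * z - x) / e n))) \<partial>lborel)"
      using e[of n] by simp
    also have "\<dots> = (\<integral>z. 2 * of_real pi * (f (x + e n * z) * of_real (std_normal_density z)) \<partial>lborel)"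
      using e[of n] by (intro Bochner_Integration.integral_cong) (auto simp: scaleR_conv_of_real field_simps)
    finally show ?thesis .
  qed
  have "J \<longlonglongrightarrow> (\<integral>z. 2 * of_real pi * (f x * of_real (std_normal_density z)) \<partial>lborel)"
    unfolding J
  proof (rule integral_dominated_convergence[where w = "\<lambda>z. 2 * pi * (B * std_normal_density z)"])
    show "AE z in lborel. (\<lambda>n. 2 * of_real pi * (f (x + e n * z) * of_real (std_normal_density z)))
      \<longlonglongrightarrow> 2 * of_real pi * (f x * of_real (std_normal_density z))"
    proof (rule AE_I2)
      fix z
      have "(\<lambda>n. x + e n * z) \<longlonglongrightarrow> x + 0 * z" by (intro tendsto_intros e0)
      then have "(\<lambda>n. f (x + e n * z)) \<longlonglongrightarrow> f x"
        using cont by (intro continuous_on_tendsto_compose[OF cont]) auto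
      then show "(\<lambda>n. 2 * of_real pi * (f (x + e n * z) * of_real (std_normal_density z)))
        \<longlonglongrightarrow> 2 * of_real pi * (f x * of_real (std_normal_density z))"
        by (intro tendsto_intros)
    qed
    show "AE z in lborel. norm (2 * of_real pi * (f (x + e n * z) * of_real (std_normal_density z))) \<le> 2 * pi * (B * std_normal_density z)" for n
      using bdd by (auto simp: norm_mult normal_density_nonneg intro!: mult_right_mono)
  qed auto
  also have "(\<integral>z. 2 * of_real pi * (f x * of_real (std_normal_density z)) \<partial>lborel) = 2 * of_real pi * f x"
    by simp
  finally show "J \<longlonglongrightarrow> 2 * of_real pi * f x" .
qed

text \<open>Euler's integral after the substitution t = exp y. For s = c + \<i> t it exhibits Gamma
  as the Fourier transform of exp (c y - exp y).\<close>

lemma Gamma_exp_integral: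
  fixes s :: complex
  assumes "Re s > 0"
  shows "integrable lborel (\<lambda>y. exp (s * of_real y - of_real (exp y)))"
    and "(\<integral>y. exp (s * of_real y - of_real (exp y)) \<partial>lborel) = Gamma s"
proof -
  define F where "F = (\<lambda>t. complex_of_real t powr (s - 1) / of_real (exp t))"
  have "range exp = {0::real<..}"
    using exp_ln by (auto simp: image_iff) (metis exp_ln)
  then have "F absolutely_integrable_on exp ` UNIV \<and> integral (exp ` UNIV) F = Gamma s"
    using absolutely_integrable_Gamma_integral'[OF assms] Gamma_integral_complex'[OF assms]
    by (auto simp: F_def has_integral_iff)
  then have "(\<lambda>y. \<bar>exp y\<bar> *\<^sub>R F (exp y)) absolutely_integrable_on UNIV \<and>
      integral UNIV (\<lambda>y. \<bar>exp y\<bar> *\<^sub>R F (exp y)) = Gamma s"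
    by (subst has_absolute_integral_change_of_variables_real)
       (auto intro!: derivative_eq_intros simp: inj_def)
  moreover have "\<bar>exp y\<bar> *\<^sub>R F (exp y) = exp (s * of_real y - of_real (exp y))" for y :: real
    by (simp add: F_def scaleR_conv_of_real powr_def Ln_of_real algebra_simps exp_diff exp_of_real field_simps flip: exp_of_real)
  ultimately have *: "integrable lebesgue (\<lambda>y. exp (s * of_real y - of_real (exp y)))"
      "integral UNIV (\<lambda>y. exp (s * of_real y - of_real (exp y))) = Gamma s"
    by (simp_all add: set_integrable_def)
  have [measurable]: "(\<lambda>y. exp (s * of_real y - of_real (exp y))) \<in> borel_measurable lborel"
    by measurable
  show int: "integrable lborel (\<lambda>y. exp (s * of_real y - of_real (exp y)))"
    using * by (simp add: integrable_completion)
  show "(\<integral>y. exp (s * of_real y - of_real (exp y)) \<partial>lborel) = Gamma s"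
    using integral_lborel[OF int] * by simp
qed

lemma finite_nonpos_Ints_strip:
  "finite {s \<in> \<int>\<^sub>\<le>\<^sub>0. \<bar>Re s\<bar> \<le> R}"
proof -
  have "{s \<in> \<int>\<^sub>\<le>\<^sub>0. \<bar>Re s\<bar> \<le> R} \<subseteq> (\<lambda>n. - of_nat n) ` {..nat \<lceil>R\<rceil>}"
  proof
    fix s :: complex assume s: "s \<in> {s \<in> \<int>\<^sub>\<le>\<^sub>0. \<bar>Re s\<bar> \<le> R}"
    then obtain n where n: "s = - of_nat n" by (auto elim: nonpos_Ints_cases')
    then have "real n \<le> R" using s by auto
    then have "n \<le> nat \<lceil>R\<rceil>" by linarith
    then show "s \<in> (\<lambda>n. - of_nat n) ` {..nat \<lceil>R\<rceil>}" using n by auto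
  qed
  then show ?thesis by (rule finite_subset) auto
qed

lemma Gamma_mellin_barnes: "mellin_barnes_integrand Gamma \<int>\<^sub>\<le>\<^sub>0"
proof
  show "Gamma holomorphic_on - \<int>\<^sub>\<le>\<^sub>0" by (intro holomorphic_intros) auto
  show "Im s = 0" if "s \<in> \<int>\<^sub>\<le>\<^sub>0" for s using that by (auto elim!: nonpos_Ints_cases)
  show "finite {s \<in> \<int>\<^sub>\<le>\<^sub>0. \<bar>Re s\<bar> \<le> R}" for R by (rule finite_nonpos_Ints_strip)
  show "\<exists>C\<ge>0. \<forall>s. a \<le> Re s \<and> Re s \<le> b \<and> \<bar>Im s\<bar> \<ge> 1 \<longrightarrow> norm (Gamma s) \<le> C / (Im s)\<^sup>2" for a b
    using Gamma_strip_decay[of a b 2] by simp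
qed

lemma Gamma_vertical_continuous:
  fixes c :: real
  assumes "c > 0"
  shows "continuous_on UNIV (\<lambda>t. Gamma (Complex c t))"
proof (rule continuous_on_compose2[OF continuous_on_Gamma])
  show "continuous_on UNIV (Complex c)"
    by (simp add: Complex_eq[abs_def] continuous_intros)
  show "Complex c ` UNIV \<subseteq> - \<int>\<^sub>\<le>\<^sub>0"
    using assms by (auto elim!: nonpos_Ints_cases' simp: complex_eq_iff)
qed auto

lemma Gamma_vertical_integrable:
  fixes c :: real
  assumes "c > 0"
  shows "integrable lborel (\<lambda>t. Gamma (Complex c t))"
proof -
  have "(\<lambda>t. Gamma (Complex c t)) absolutely_integrable_on UNIV"
    by (rule mellin_barnes_integrand.vertical_integrable[OF Gamma_mellin_barnes])
       (use assms in \<open>auto elim!: nonpos_Ints_cases'\<close>)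
  moreover have "(\<lambda>t. Gamma (Complex c t)) \<in> borel_measurable lborel"
    using borel_measurable_continuous_onI[OF Gamma_vertical_continuous[OF assms]] by simp
  ultimately show ?thesis by (simp add: set_integrable_def integrable_completion)
qed

text \<open>Fourier inversion at the point ln x for y \<mapsto> exp (c y - exp y). The weight x^c in
  the value at ln x is removed by multiplying with x^(-c), which also completes the phase to
  x^(-s).\<close>

theorem cahen_mellin:
  fixes c x :: real
  assumes c: "c > 0" and x: "x > 0"
  shows "(\<integral>t. Gamma (Complex c t) * of_real x powr (- Complex c t) \<partial>lborel) = of_real (2 * pi * exp (- x))"
proof -
  define f where "f y = complex_of_real (exp (c * y - exp y))" for y
  have f': "f y * exp (\<i> * of_real (t * y)) = exp (Complex c t * of_real y - of_real (exp y))" for t y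
    by (simp add: f_def Complex_eq exp_of_real[symmetric] exp_add[symmetric] algebra_simps)
  have G: "(\<integral>y. f y * exp (\<i> * of_real (t * y)) \<partial>lborel) = Gamma (Complex c t)" for t
    unfolding f' by (rule Gamma_exp_integral) (use c in auto)
  have "(\<integral>t. (\<integral>y. f y * exp (\<i> * of_real (t * y)) \<partial>lborel) * exp (- (\<i> * of_real (t * ln x))) \<partial>lborel)
      = 2 * of_real pi * f (ln x)"
  proof (rule fourier_inversion)
    show "continuous_on UNIV f" unfolding f_def by (intro continuous_intros)
    show "integrable lborel f"
      using Gamma_exp_integral(1)[of c] c by (simp add: f_def[abs_def] exp_of_real[symmetric])
    show "integrable lborel (\<lambda>t. \<integral>y. f y * exp (\<i> * of_real (t * y)) \<partial>lborel)"
      unfolding G by (rule Gamma_vertical_integrable) fact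
    fix y
    \<comment> \<open>The exponent c y - exp y is largest at y = ln c; 1 + u \<le> exp u at u = y -
      ln c gives this maximum as the bound.\<close>
    have "c * (1 + (y - ln c)) \<le> c * exp (y - ln c)"
      using c exp_ge_add_one_self[of "y - ln c"] by (intro mult_left_mono) auto
    also have "\<dots> = exp y" using c by (simp add: exp_diff)
    finally have "c * y - exp y \<le> c * (ln c - 1)" by (simp add: algebra_simps)
    then show "norm (f y) \<le> exp (c * (ln c - 1))" by (simp add: f_def)
  qed
  then have "(\<integral>t. Gamma (Complex c t) * exp (- (\<i> * of_real (t * ln x))) \<partial>lborel)
      = 2 * of_real pi * f (ln x)" by (simp only: G)
  then have "of_real (x powr - c) * (\<integral>t. Gamma (Complex c t) * exp (- (\<i> * of_real (t * ln x))) \<partial>lborel)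
      = of_real (x powr - c) * (2 * of_real pi * f (ln x))" by simp
  also have "of_real (x powr - c) * (2 * of_real pi * f (ln x)) = of_real (2 * pi * exp (- x))"
  proof -
    have "x powr - c * (2 * pi * exp (c * ln x - exp (ln x))) = 2 * pi * exp (- x)"
      using x by (simp add: powr_def exp_diff exp_minus field_simps)
    then have "complex_of_real (x powr - c * (2 * pi * exp (c * ln x - exp (ln x)))) = of_real (2 * pi * exp (- x))"
      by (simp only:)
    then show ?thesis by (simp add: f_def)
  qed
  also have "of_real (x powr - c) * (\<integral>t. Gamma (Complex c t) * exp (- (\<i> * of_real (t * ln x))) \<partial>lborel)
      = (\<integral>t. Gamma (Complex c t) * of_real x powr (- Complex c t) \<partial>lborel)"
  proof -
    have "of_real x powr (- Complex c t) = of_real (x powr - c) * exp (- (\<i> * of_real (t * ln x)))" for t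
      using x by (simp add: powr_def Ln_of_real Complex_eq exp_of_real[symmetric] exp_add[symmetric] algebra_simps)
    then show ?thesis
      by (simp only: integral_mult_right_zero[symmetric] mult.left_commute)
  qed
  finally show ?thesis .
qed

text \<open>The substitution t \<mapsto> r t in \<open>cahen_mellin\<close> at x^(1/r), since
  (x^(1/r))^(-r s) = x^(-s).\<close>

lemma cahen_mellin_root:
  fixes c x :: real
  assumes c: "c > 0" and x: "x > 0" and r: "r > 0"
  shows "(\<integral>t. Gamma (of_real r * Complex c t) * of_real x powr (- Complex c t) \<partial>lborel)
         = of_real (2 * pi / r * exp (- (x powr (1 / r))))"
proof -
  have "of_real (2 * pi * exp (- (x powr (1 / r)))) =
      (\<integral>t. Gamma (Complex (r * c) t) * of_real (x powr (1 / r)) powr (- Complex (r * c) t) \<partial>lborel)"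
    by (rule cahen_mellin[symmetric]) (use c x r in auto)
  also have "\<dots> = \<bar>r\<bar> *\<^sub>R (\<integral>t. Gamma (Complex (r * c) (0 + r * t)) *
        of_real (x powr (1 / r)) powr (- Complex (r * c) (0 + r * t)) \<partial>lborel)"
    by (rule lborel_integral_real_affine) (use r in auto)
  also have "(\<lambda>t. Gamma (Complex (r * c) (0 + r * t)) *
        of_real (x powr (1 / r)) powr (- Complex (r * c) (0 + r * t))) =
      (\<lambda>t. Gamma (of_real r * Complex c t) * of_real x powr (- Complex c t))"
  proof
    fix t
    have C: "Complex (r * c) (0 + r * t) = of_real r * Complex c t"
      by (simp add: complex_eq_iff)
    have "complex_of_real (x powr (1 / r)) powr (- (of_real r * Complex c t)) = of_real x powr (- Complex c t)"
      using x r by (simp add: powr_def Ln_of_real ln_powr)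
    then show "Gamma (Complex (r * c) (0 + r * t)) *
        of_real (x powr (1 / r)) powr (- Complex (r * c) (0 + r * t)) =
      Gamma (of_real r * Complex c t) * of_real x powr (- Complex c t)" by (simp only: C)
  qed
  finally show ?thesis using r by (simp add: scaleR_conv_of_real field_simps)
qed

section \<open>A Mellin--Barnes integral\<close>

lemma has_integral_indicator_UNIV:
  fixes f :: "'a::euclidean_space \<Rightarrow> 'b::banach"
  shows "((\<lambda>x. indicator S x *\<^sub>R f x) has_integral i) UNIV \<longleftrightarrow> (f has_integral i) S"
proof -
  have "(\<lambda>x. indicator S x *\<^sub>R f x) = (\<lambda>x. if x \<in> S then f x else 0)" by auto
  then show ?thesis by (simp only: has_integral_restrict_UNIV)
qed

text \<open>The integrand is v^(a - 1), with antiderivative v^a / a. It is written with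
  \<open>exp\<close> and the real \<open>ln\<close> because this form is visibly measurable when
  \<open>a\<close> also varies.\<close>

lemma complex_powr_integral_0_1:
  fixes a :: complex
  assumes a: "Re a > 0"
  shows "integrable lborel (\<lambda>v. indicator {0<..<1} v *\<^sub>R exp ((a - 1) * of_real (ln v)))"
    and "(\<integral>v. indicator {0<..<1} v *\<^sub>R exp ((a - 1) * of_real (ln v)) \<partial>lborel) = 1 / a"
proof -
  have a0: "a \<noteq> 0" using a by auto
  have "((\<lambda>v. v powr (Re a - 1)) has_integral (1 powr (Re a - 1 + 1) / (Re a - 1 + 1))) {0..1}"
    using a by (intro has_integral_powr_from_0) auto
  then have "(\<lambda>v. v powr (Re a - 1)) absolutely_integrable_on {0..1}"
    by (intro nonnegative_absolutely_integrable_1) (auto simp: integrable_on_def)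
  then have "(\<lambda>v. v powr (Re a - 1)) absolutely_integrable_on {0<..<1}"
    by (rule set_integrable_subset) auto
  then have "integrable lborel (\<lambda>v. indicator {0<..<1} v *\<^sub>R v powr (Re a - 1))"
    by (simp add: set_integrable_def integrable_completion)
  then show int: "integrable lborel (\<lambda>v. indicator {0<..<1} v *\<^sub>R exp ((a - 1) * of_real (ln v)))"
    by (rule Bochner_Integration.integrable_bound)
       (auto simp: indicator_def powr_def)
  have "((\<lambda>v. exp ((a - 1) * of_real (ln v))) has_integral
      (complex_of_real 1 powr a / a - complex_of_real 0 powr a / a)) {0..1}"
  proof (rule fundamental_theorem_of_calculus_interior)
    show "continuous_on {0..1} (\<lambda>v. complex_of_real v powr a / a)"
    proof -
      have "((\<lambda>v. complex_of_real v powr a) \<longlongrightarrow> complex_of_real x powr a) (at x within {0..1})" if "x \<in> {0..1}" for x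
      proof (cases "x = 0")
        \<comment> \<open>The end point 0 lies on the branch cut; continuity there comes from Re a >
          0.\<close>
        case True
        then show ?thesis
          using a a0 by (auto intro!: tendsto_powr_complex_0 tendsto_eq_intros)
      next
        case False
        then show ?thesis using that a0
          by (intro tendsto_powr_complex tendsto_intros) (auto simp: complex_nonpos_Reals_iff)
      qed
      then have "continuous_on {0..1} (\<lambda>v. complex_of_real v powr a)" by (simp add: continuous_on_def)
      then show ?thesis by (intro continuous_on_divide continuous_on_const) (use a0 in auto)
    qed
    fix v :: real assume v: "v \<in> {0<..<1}"
    have "((\<lambda>w. w powr a / a) has_field_derivative of_real v powr (a - 1)) (at (of_real v))"
      using v a0 by (auto intro!: derivative_eq_intros simp: complex_nonpos_Reals_iff)
    then have "((\<lambda>v. complex_of_real v powr a / a) has_vector_derivative of_real v powr (a - 1)) (at v)"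
      by (rule has_vector_derivative_real_field)
    then show "((\<lambda>v. complex_of_real v powr a / a) has_vector_derivative exp ((a - 1) * of_real (ln v))) (at v)"
      using v by (simp add: powr_def Ln_of_real)
  qed auto
  then have "((\<lambda>v. exp ((a - 1) * of_real (ln v))) has_integral 1 / a) {0<..<1}"
    using a0 by (simp add: has_integral_Icc_iff_Ioo)
  then have "((\<lambda>v. indicator {0<..<1} v *\<^sub>R exp ((a - 1) * of_real (ln v))) has_integral 1 / a) UNIV"
    by (simp only: has_integral_indicator_UNIV)
  then show "(\<integral>v. indicator {0<..<1} v *\<^sub>R exp ((a - 1) * of_real (ln v)) \<partial>lborel) = 1 / a"
    using integral_lborel[OF int] by (simp add: integral_unique)
qed

lemma Gamma_lborel_integral:
  fixes a :: complex
  assumes a: "Re a > 0"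
  shows "integrable lborel (\<lambda>x. indicator {0<..} x *\<^sub>R exp ((a - 1) * of_real (ln x) - of_real x))"
    and "(\<integral>x. indicator {0<..} x *\<^sub>R exp ((a - 1) * of_real (ln x) - of_real x) \<partial>lborel) = Gamma a"
proof -
  have eq: "(\<lambda>x. indicator {0<..} x *\<^sub>R (complex_of_real x powr (a - 1) / of_real (exp x))) =
      (\<lambda>x. indicator {0<..} x *\<^sub>R exp ((a - 1) * of_real (ln x) - of_real x))"
    by (auto simp: fun_eq_iff indicator_def powr_def Ln_of_real exp_diff exp_of_real)
  have [measurable]: "(\<lambda>x. indicator {0<..} x *\<^sub>R exp ((a - 1) * of_real (ln x) - of_real x)) \<in> borel_measurable lborel"
    by measurable
  show int: "integrable lborel (\<lambda>x. indicator {0<..} x *\<^sub>R exp ((a - 1) * of_real (ln x) - of_real x))"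
    using absolutely_integrable_Gamma_integral'[OF a]
    by (simp add: set_integrable_def eq integrable_completion)
  have "((\<lambda>x. indicator {0<..} x *\<^sub>R (complex_of_real x powr (a - 1) / of_real (exp x))) has_integral Gamma a) UNIV"
    using Gamma_integral_complex'[OF a]
    by (simp only: has_integral_indicator_UNIV)
  then show "(\<integral>x. indicator {0<..} x *\<^sub>R exp ((a - 1) * of_real (ln x) - of_real x) \<partial>lborel) = Gamma a"
    unfolding eq using integral_lborel[OF int] by (simp add: integral_unique)
qed

lemma Gamma_scaled_vertical_integrable:
  fixes c r :: real
  assumes "c > 0" "r > 0"
  shows "integrable lborel (\<lambda>t. Gamma (of_real r * Complex c t))"
proof -
  have "integrable lborel (\<lambda>t. Gamma (Complex (r * c) (0 + r * t)))"
    using assms by (intro lborel_integrable_real_affine Gamma_vertical_integrable) auto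
  moreover have "Complex (r * c) (0 + r * t) = of_real r * Complex c t" for t
    by (simp add: complex_eq_iff)
  ultimately show ?thesis by simp
qed

text \<open>An incomplete gamma function: \<open>v = (t / y\<^bsup>1/r\<^esup>)\<^sup>r\<close> turns it into an integral of \<open>t\<^bsup>r \<beta> - 1\<^esup> e\<^sup>-\<^sup>t\<close> over
  \<open>0 < t < y\<^bsup>1/r\<^esup>\<close>.\<close>

definition incomplete_kernel :: "real \<Rightarrow> real \<Rightarrow> real \<Rightarrow> real" where
  "incomplete_kernel r \<beta> y = (\<integral>v. indicator {0<..<1} v * (v powr (\<beta> - 1) * exp (- ((y * v) powr (1 / r)))) \<partial>lborel)"

lemma mellin_barnes_incomplete_kernel:
  fixes r \<beta> c y :: real
  assumes r: "r > 0" and c: "0 < c" "c < \<beta>" and y: "y > 0"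
  shows "(\<integral>t. Gamma (of_real r * Complex c t) / (of_real \<beta> - Complex c t) * of_real y powr (- Complex c t) \<partial>lborel)
    = of_real (2 * pi / r * incomplete_kernel r \<beta> y)"
proof -
  define H where "H t = Gamma (of_real r * Complex c t)" for t
  have H: "integrable lborel H"
    unfolding H_def[abs_def] by (rule Gamma_scaled_vertical_integrable) (use r c in auto)
  then have [measurable]: "H \<in> borel_measurable borel" by (auto dest: borel_measurable_integrable)
  \<comment> \<open>\<open>Complex c t\<close> is spelled out as a sum so that joint measurability
    reduces to arithmetic operations.\<close>
  define F where "F v t = (indicator {0<..<1} v *\<^sub>R exp ((of_real \<beta> - (of_real c + \<i> * of_real t) - 1) * of_real (ln v))) *
     (H t * exp (- ((of_real c + \<i> * of_real t) * of_real (ln y))))" for v t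
  have ypow: "of_real y powr (- Complex c t) = exp (- ((of_real c + \<i> * of_real t) * of_real (ln y)))" for t
    using y by (simp add: powr_def Ln_of_real Complex_eq algebra_simps)
  have "(\<integral>v. F v t \<partial>lborel) = H t / (of_real \<beta> - Complex c t) * of_real y powr (- Complex c t)" for t
  proof -
    have "(\<integral>v. F v t \<partial>lborel) = (\<integral>v. indicator {0<..<1} v *\<^sub>R exp (((of_real \<beta> - Complex c t) - 1) * of_real (ln v)) \<partial>lborel) *
       (H t * of_real y powr (- Complex c t))"
      unfolding F_def ypow[symmetric] by (simp only: integral_mult_left_zero Complex_eq)
    also have "\<dots> = H t / (of_real \<beta> - Complex c t) * of_real y powr (- Complex c t)"
      by (subst complex_powr_integral_0_1) (use c in auto)
    finally show ?thesis .
  qed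
  then have "(\<integral>t. Gamma (of_real r * Complex c t) / (of_real \<beta> - Complex c t) * of_real y powr (- Complex c t) \<partial>lborel)
     = (\<integral>t. (\<integral>v. F v t \<partial>lborel) \<partial>lborel)"
    by (simp only: H_def)
  also have "\<dots> = (\<integral>v. (\<integral>t. F v t \<partial>lborel) \<partial>lborel)"
  proof (rule lborel_Fubini_dominated[symmetric])
    show "case_prod F \<in> borel_measurable (lborel \<Otimes>\<^sub>M lborel)"
      unfolding F_def by measurable
    \<comment> \<open>On Re s = c the modulus of v^(\<beta> - s - 1) is v^(\<beta> - c - 1),
      independent of t and integrable near 0 because c < \<beta>.\<close>
    show "integrable lborel (\<lambda>v. norm (indicator {0<..<1} v *\<^sub>R exp ((of_real (\<beta> - c) - 1) * complex_of_real (ln v))))"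
      by (intro integrable_norm complex_powr_integral_0_1) (use c in auto)
    show "integrable lborel (\<lambda>t. norm (H t) * exp (- (c * ln y)))"
      using H by simp
    show "norm (F v t) \<le> norm (indicator {0<..<1} v *\<^sub>R exp ((of_real (\<beta> - c) - 1) * complex_of_real (ln v))) *
        (norm (H t) * exp (- (c * ln y)))" for v t
      by (simp add: F_def norm_mult)
  qed
  also have "\<dots> = (\<integral>v. complex_of_real (2 * pi / r * (indicator {0<..<1} v * (v powr (\<beta> - 1) * exp (- ((y * v) powr (1 / r)))))) \<partial>lborel)"
  proof (rule Bochner_Integration.integral_cong)
    fix v :: real
    show "(\<integral>t. F v t \<partial>lborel) = complex_of_real (2 * pi / r * (indicator {0<..<1} v * (v powr (\<beta> - 1) * exp (- ((y * v) powr (1 / r))))))"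
    proof (cases "v \<in> {0<..<1}")
      case True
      then have v: "v > 0" by simp
      have pw: "of_real (y * v) powr (- Complex c t) =
          exp (- ((of_real c + \<i> * of_real t) * (of_real (ln y) + of_real (ln v))))" for t
      proof -
        have "of_real (y * v) powr (- Complex c t) = exp (- Complex c t * of_real (ln (y * v)))"
          using True y by (simp add: powr_def Ln_of_real del: of_real_mult)
        then show ?thesis using True y by (simp add: ln_mult Complex_eq algebra_simps)
      qed
      have "F v t = of_real (v powr (\<beta> - 1)) * (H t * of_real (y * v) powr (- Complex c t))" for t
        unfolding pw using True
        by (simp add: F_def powr_def exp_of_real[symmetric] exp_add[symmetric])
           (simp add: algebra_simps exp_add[symmetric])
      then have "(\<integral>t. F v t \<partial>lborel) = of_real (v powr (\<beta> - 1)) * (\<integral>t. H t * of_real (y * v) powr (- Complex c t) \<partial>lborel)"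
        by (simp only: integral_mult_right_zero)
      also have "(\<integral>t. H t * of_real (y * v) powr (- Complex c t) \<partial>lborel) = of_real (2 * pi / r * exp (- ((y * v) powr (1 / r))))"
        unfolding H_def by (rule cahen_mellin_root) (use c y v r in auto)
      finally show ?thesis using True by (simp add: mult_ac)
    qed (simp add: F_def)
  qed simp
  also have "\<dots> = of_real (2 * pi / r * incomplete_kernel r \<beta> y)"
    unfolding integral_complex_of_real incomplete_kernel_def by simp
  finally show ?thesis .
qed

text \<open>Only Gamma(p + \<beta> - s) is expanded here. With 1 / (\<beta> - s) left inside
  \<open>H\<close>, the inner t-integral is \<open>mellin_barnes_incomplete_kernel\<close> at y = w
  x, so that a second double integral replaces a triple one.\<close>

theorem mellin_barnes_double_integral:
  fixes r \<beta> p c w :: real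
  assumes r: "r > 0" and c: "0 < c" "c < \<beta>" and w: "w > 0" and p: "p > 0"
  shows "(\<integral>t. Gamma (of_real r * Complex c t) * Gamma (of_real (p + \<beta>) - Complex c t) / (of_real \<beta> - Complex c t) *
        of_real w powr (- Complex c t) \<partial>lborel)
    = of_real (2 * pi / r * (\<integral>x. indicator {0<..} x * (exp (- x) * x powr (p + \<beta> - 1) * incomplete_kernel r \<beta> (w * x)) \<partial>lborel))"
proof -
  define H where "H t = Gamma (of_real r * Complex c t) / (of_real \<beta> - Complex c t)" for t
  have Gm [measurable]: "(\<lambda>t. Gamma (of_real r * Complex c t)) \<in> borel_measurable borel"
    using Gamma_scaled_vertical_integrable[OF c(1) r] by (auto dest: borel_measurable_integrable)
  have H_meas [measurable]: "H \<in> borel_measurable borel" unfolding H_def Complex_eq[of c]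
    using Gm unfolding Complex_eq by measurable
  have Hle: "norm (H t) \<le> norm (Gamma (of_real r * Complex c t)) * (1 / (\<beta> - c))" for t
  proof -
    \<comment> \<open>The distance from \<beta> to the line Re s = c.\<close>
    have "\<beta> - c \<le> norm (of_real \<beta> - Complex c t)"
      using abs_Re_le_cmod[of "of_real \<beta> - Complex c t"] c by simp
    then have "norm (Gamma (of_real r * Complex c t)) / norm (of_real \<beta> - Complex c t) \<le>
        norm (Gamma (of_real r * Complex c t)) / (\<beta> - c)"
      using c by (intro divide_left_mono mult_pos_pos) auto
    then show ?thesis by (simp add: H_def norm_divide)
  qed
  have H: "integrable lborel H"
  proof (rule Bochner_Integration.integrable_bound)
    show "integrable lborel (\<lambda>t. norm (Gamma (of_real r * Complex c t)) * (1 / (\<beta> - c)))"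
      using Gamma_scaled_vertical_integrable[OF c(1) r] by (intro integrable_mult_left integrable_norm)
  qed (use order_trans[OF Hle abs_ge_self] in auto)
  define F where "F x t = (indicator {0<..} x *\<^sub>R exp ((of_real (p + \<beta>) - (of_real c + \<i> * of_real t) - 1) * of_real (ln x) - of_real x)) *
     (H t * exp (- ((of_real c + \<i> * of_real t) * of_real (ln w))))" for x t
  have wpow: "of_real w powr (- Complex c t) = exp (- ((of_real c + \<i> * of_real t) * of_real (ln w)))" for t
    using w by (simp add: powr_def Ln_of_real Complex_eq algebra_simps)
  have "(\<integral>x. F x t \<partial>lborel) = Gamma (of_real r * Complex c t) * Gamma (of_real (p + \<beta>) - Complex c t) / (of_real \<beta> - Complex c t) *
      of_real w powr (- Complex c t)" for t
  proof -
    have "(\<integral>x. F x t \<partial>lborel) = (\<integral>x. indicator {0<..} x *\<^sub>R exp (((of_real (p + \<beta>) - Complex c t) - 1) * of_real (ln x) - of_real x) \<partial>lborel) *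
       (H t * of_real w powr (- Complex c t))"
      unfolding F_def wpow[symmetric] by (simp only: integral_mult_left_zero Complex_eq)
    also have "\<dots> = Gamma (of_real (p + \<beta>) - Complex c t) * (H t * of_real w powr (- Complex c t))"
      by (subst Gamma_lborel_integral) (use c p in auto)
    finally show ?thesis by (simp add: H_def)
  qed
  then have "(\<integral>t. Gamma (of_real r * Complex c t) * Gamma (of_real (p + \<beta>) - Complex c t) / (of_real \<beta> - Complex c t) *
        of_real w powr (- Complex c t) \<partial>lborel)
     = (\<integral>t. (\<integral>x. F x t \<partial>lborel) \<partial>lborel)"
    by (simp only:)
  also have "\<dots> = (\<integral>x. (\<integral>t. F x t \<partial>lborel) \<partial>lborel)"
  proof (rule lborel_Fubini_dominated[symmetric])
    show "case_prod F \<in> borel_measurable (lborel \<Otimes>\<^sub>M lborel)"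
      unfolding F_def by measurable
    show "integrable lborel (\<lambda>x. norm (indicator {0<..} x *\<^sub>R exp ((of_real (p + \<beta> - c) - 1) * complex_of_real (ln x) - of_real x)))"
      by (intro integrable_norm Gamma_lborel_integral) (use c p in auto)
    show "integrable lborel (\<lambda>t. norm (H t) * exp (- (c * ln w)))"
      using H by simp
    show "norm (F x t) \<le> norm (indicator {0<..} x *\<^sub>R exp ((of_real (p + \<beta> - c) - 1) * complex_of_real (ln x) - of_real x)) *
        (norm (H t) * exp (- (c * ln w)))" for x t
      by (simp add: F_def norm_mult)
  qed
  also have "\<dots> = (\<integral>x. complex_of_real (2 * pi / r * (indicator {0<..} x * (exp (- x) * x powr (p + \<beta> - 1) * incomplete_kernel r \<beta> (w * x)))) \<partial>lborel)"
  proof (rule Bochner_Integration.integral_cong)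
    fix x :: real
    show "(\<integral>t. F x t \<partial>lborel) = complex_of_real (2 * pi / r * (indicator {0<..} x * (exp (- x) * x powr (p + \<beta> - 1) * incomplete_kernel r \<beta> (w * x))))"
    proof (cases "x > 0")
      case True
      have pw: "of_real (w * x) powr (- Complex c t) =
          exp (- ((of_real c + \<i> * of_real t) * (of_real (ln w) + of_real (ln x))))" for t
      proof -
        have "of_real (w * x) powr (- Complex c t) = exp (- Complex c t * of_real (ln (w * x)))"
          using True w by (simp add: powr_def Ln_of_real del: of_real_mult)
        then show ?thesis using True w by (simp add: ln_mult Complex_eq algebra_simps)
      qed
      have "F x t = of_real (exp (- x) * x powr (p + \<beta> - 1)) * (H t * of_real (w * x) powr (- Complex c t))" for t
        unfolding pw using True
        by (simp add: F_def powr_def exp_of_real[symmetric] exp_add[symmetric])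
           (simp add: algebra_simps exp_add[symmetric])
      then have "(\<integral>t. F x t \<partial>lborel) = of_real (exp (- x) * x powr (p + \<beta> - 1)) * (\<integral>t. H t * of_real (w * x) powr (- Complex c t) \<partial>lborel)"
        by (simp only: integral_mult_right_zero)
      also have "(\<integral>t. H t * of_real (w * x) powr (- Complex c t) \<partial>lborel) = of_real (2 * pi / r * incomplete_kernel r \<beta> (w * x))"
        unfolding H_def by (rule mellin_barnes_incomplete_kernel) (use c w True r in auto)
      finally show ?thesis using True by (simp add: mult_ac)
    qed (simp add: F_def)
  qed simp
  also have "\<dots> = of_real (2 * pi / r * (\<integral>x. indicator {0<..} x * (exp (- x) * x powr (p + \<beta> - 1) * incomplete_kernel r \<beta> (w * x)) \<partial>lborel))"
    unfolding integral_complex_of_real by simp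
  finally show ?thesis .
qed

section \<open>Evaluation of the G-function\<close>

text \<open>Makes the pole conditions of \<open>meijer_contour\<close> arithmetic. Elsewhere Gamma
  has a finite limit, which excludes a pole.\<close>

lemma is_pole_Gamma_add_iff: "is_pole (\<lambda>s. Gamma (b + s :: complex)) s \<longleftrightarrow> b + s \<in> \<int>\<^sub>\<le>\<^sub>0"
proof
  assume "b + s \<in> \<int>\<^sub>\<le>\<^sub>0"
  then obtain n where n: "b + s = - of_nat n" by (auto elim: nonpos_Ints_cases')
  have "filterlim (\<lambda>s. b + s) (at (b + s)) (at s)"
    by (intro filterlim_atI tendsto_intros) (auto simp: eventually_at_filter)
  moreover have "filterlim Gamma at_infinity (at (b + s))"
    unfolding n by (rule Gamma_poles)
  ultimately show "is_pole (\<lambda>s. Gamma (b + s)) s"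
    unfolding is_pole_def by (rule filterlim_compose[rotated])
next
  assume pole: "is_pole (\<lambda>s. Gamma (b + s)) s"
  show "b + s \<in> \<int>\<^sub>\<le>\<^sub>0"
  proof (rule ccontr)
    assume "b + s \<notin> \<int>\<^sub>\<le>\<^sub>0"
    then have "((\<lambda>s. Gamma (b + s)) \<longlongrightarrow> Gamma (b + s)) (at s)"
      by (intro tendsto_Gamma tendsto_intros)
    then show False
      using pole not_tendsto_and_filterlim_at_infinity[of "at s" "\<lambda>s. Gamma (b + s)"]
      by (auto simp: is_pole_def)
  qed
qed

lemma is_pole_Gamma_diff_iff: "is_pole (\<lambda>s. Gamma (b - s :: complex)) s \<longleftrightarrow> b - s \<in> \<int>\<^sub>\<le>\<^sub>0"
proof
  assume "b - s \<in> \<int>\<^sub>\<le>\<^sub>0"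
  then obtain n where n: "b - s = - of_nat n" by (auto elim: nonpos_Ints_cases')
  have "filterlim (\<lambda>s. b - s) (at (b - s)) (at s)"
    by (intro filterlim_atI tendsto_intros) (auto simp: eventually_at_filter)
  moreover have "filterlim Gamma at_infinity (at (b - s))"
    unfolding n by (rule Gamma_poles)
  ultimately show "is_pole (\<lambda>s. Gamma (b - s)) s"
    unfolding is_pole_def by (rule filterlim_compose[rotated])
next
  assume pole: "is_pole (\<lambda>s. Gamma (b - s)) s"
  show "b - s \<in> \<int>\<^sub>\<le>\<^sub>0"
  proof (rule ccontr)
    assume "b - s \<notin> \<int>\<^sub>\<le>\<^sub>0"
    then have "((\<lambda>s. Gamma (b - s)) \<longlongrightarrow> Gamma (b - s)) (at s)"
      by (intro tendsto_Gamma tendsto_intros)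
    then show False
      using pole not_tendsto_and_filterlim_at_infinity[of "at s" "\<lambda>s. Gamma (b - s)"]
      by (auto simp: is_pole_def)
  qed
qed

lemma finite_Gamma_poles_strip:
  fixes b :: complex
  shows "finite {s. b + s \<in> \<int>\<^sub>\<le>\<^sub>0 \<and> \<bar>Re s\<bar> \<le> R}" "finite {s. b - s \<in> \<int>\<^sub>\<le>\<^sub>0 \<and> \<bar>Re s\<bar> \<le> R}"
proof -
  let ?S = "{u \<in> \<int>\<^sub>\<le>\<^sub>0. \<bar>Re u\<bar> \<le> R + \<bar>Re b\<bar>}"
  have "{s. b + s \<in> \<int>\<^sub>\<le>\<^sub>0 \<and> \<bar>Re s\<bar> \<le> R} \<subseteq> (\<lambda>u. u - b) ` ?S"
  proof
    fix s assume "s \<in> {s. b + s \<in> \<int>\<^sub>\<le>\<^sub>0 \<and> \<bar>Re s\<bar> \<le> R}"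
    then have "b + s \<in> ?S" by auto
    then show "s \<in> (\<lambda>u. u - b) ` ?S" by (intro image_eqI[of _ _ "b + s"]) auto
  qed
  then show "finite {s. b + s \<in> \<int>\<^sub>\<le>\<^sub>0 \<and> \<bar>Re s\<bar> \<le> R}"
    by (rule finite_subset) (simp add: finite_nonpos_Ints_strip)
  have "{s. b - s \<in> \<int>\<^sub>\<le>\<^sub>0 \<and> \<bar>Re s\<bar> \<le> R} \<subseteq> (\<lambda>u. b - u) ` ?S"
  proof
    fix s assume "s \<in> {s. b - s \<in> \<int>\<^sub>\<le>\<^sub>0 \<and> \<bar>Re s\<bar> \<le> R}"
    then have "b - s \<in> ?S" by auto
    then show "s \<in> (\<lambda>u. b - u) ` ?S" by (intro image_eqI[of _ _ "b - s"]) auto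
  qed
  then show "finite {s. b - s \<in> \<int>\<^sub>\<le>\<^sub>0 \<and> \<bar>Re s\<bar> \<le> R}"
    by (rule finite_subset) (simp add: finite_nonpos_Ints_strip)
qed

lemma upward_contour_vertical: "upward_contour (Complex c)"
  unfolding upward_contour_def
proof (intro conjI)
  have "Complex c = (\<lambda>t. of_real c + of_real t * \<i>)" by (auto simp: complex_eq_iff)
  moreover have "(\<lambda>t. of_real c + of_real t * \<i>) C1_differentiable_on UNIV"
    unfolding C1_differentiable_on_def
    by (intro exI[of _ "\<lambda>_. \<i>"]) (auto intro!: derivative_eq_intros)
  ultimately show "Complex c piecewise_C1_differentiable_on UNIV"
    by (simp add: C1_differentiable_imp_piecewise)
qed (auto simp: inj_def)

text \<open>Provides the witness that gives \<open>SOME\<close> in \<open>meijer_G\<close> its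
  meaning. A pole on the correct side of a vertical line is its own witness \<open>w\<close>, as it
  lies beyond every point of the line.\<close>

lemma meijer_contour_exists:
  assumes left: "\<And>i. i < m \<Longrightarrow> c > - Re (bs ! i)" and right: "\<And>i. i < n \<Longrightarrow> c < 1 - Re (as ! i)"
  shows "meijer_contour m n as bs (Complex c)"
  unfolding meijer_contour_def
proof (intro conjI allI impI upward_contour_vertical)
  fix i s assume i: "i < m" and pole: "is_pole (\<lambda>s. Gamma (bs ! i + s)) s"
  then obtain k where k: "bs ! i + s = - of_nat k"
    by (auto simp: is_pole_Gamma_add_iff elim: nonpos_Ints_cases')
  have "Re (bs ! i) + Re s = - of_nat k" using arg_cong[OF k, of Re] by simp
  then have "Re s < c" using left[OF i] by linarith
  then show "left_of_contour (Complex c) s"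
    unfolding left_of_contour_def by (intro exI[of _ s]) (auto intro!: connected_component_refl)
next
  fix i s assume i: "i < n" and pole: "is_pole (\<lambda>s. Gamma (1 - as ! i - s)) s"
  then obtain k where k: "1 - as ! i - s = - of_nat k"
    by (auto simp: is_pole_Gamma_diff_iff elim: nonpos_Ints_cases')
  have "1 - Re (as ! i) - Re s = - of_nat k"
    using arg_cong[OF k, of Re] by simp
  then have "c < Re s" using right[OF i] by linarith
  then show "right_of_contour (Complex c) s"
    unfolding right_of_contour_def by (intro exI[of _ s]) (auto intro!: connected_component_refl)
qed

text \<open>The arbitrary contour is traded for the line Re s = c; the \<i> from ds cancels the one
  in 1 / (2 pi \<i>). On the line the convergence is absolute, so the value is a Lebesgue integral,
  ready for Fubini.\<close>

theorem meijer_G_eq_vertical_integral: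
  assumes hol: "mellin_barnes_integrand (meijer_integrand m n as bs z)
      ({s. \<exists>i<m. bs ! i + s \<in> \<int>\<^sub>\<le>\<^sub>0} \<union> {s. \<exists>i<n. 1 - as ! i - s \<in> \<int>\<^sub>\<le>\<^sub>0})"
    and left: "\<And>i. i < m \<Longrightarrow> c > - Re (bs ! i)" and right: "\<And>i. i < n \<Longrightarrow> c < 1 - Re (as ! i)"
  shows "meijer_G m n as bs z = (\<integral>t. meijer_integrand m n as bs z (Complex c t) \<partial>lborel) / (2 * of_real pi)"
proof -
  define A where "A = {s. \<exists>i<m. bs ! i + s \<in> \<int>\<^sub>\<le>\<^sub>0}"
  define B where "B = {s. \<exists>i<n. 1 - as ! i - s \<in> \<int>\<^sub>\<le>\<^sub>0}"
  define f where "f = meijer_integrand m n as bs z"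
  define L where "L = (SOME L. meijer_contour m n as bs L)"
  interpret mellin_barnes_integrand f "A \<union> B" using hol by (simp add: f_def A_def B_def)
  have L: "meijer_contour m n as bs L"
    unfolding L_def
    by (rule someI[of "meijer_contour m n as bs", OF meijer_contour_exists[OF left right]])
  have A: "Re s < c \<and> left_of_contour L s" if sA: "s \<in> A" for s
  proof -
    obtain i where i: "i < m" "bs ! i + s \<in> \<int>\<^sub>\<le>\<^sub>0" using sA by (auto simp: A_def)
    then obtain k where k: "bs ! i + s = - of_nat k" by (auto elim: nonpos_Ints_cases')
    have "Re (bs ! i) + Re s = - of_nat k" using arg_cong[OF k, of Re] by simp
    then have "Re s < c" using left[OF i(1)] by linarith
    then show ?thesis using L i by (auto simp: meijer_contour_def is_pole_Gamma_add_iff)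
  qed
  have B: "c < Re s \<and> right_of_contour L s" if sB: "s \<in> B" for s
  proof -
    obtain i where i: "i < n" "1 - as ! i - s \<in> \<int>\<^sub>\<le>\<^sub>0" using sB by (auto simp: B_def)
    then obtain k where k: "1 - as ! i - s = - of_nat k" by (auto elim: nonpos_Ints_cases')
    have "1 - Re (as ! i) - Re s = - of_nat k"
      using arg_cong[OF k, of Re] by simp
    then have "c < Re s" using right[OF i(1)] by linarith
    then show ?thesis using L i by (auto simp: meijer_contour_def is_pole_Gamma_diff_iff)
  qed
  have "integral UNIV (\<lambda>t. f (L t) * vector_derivative L (at t)) = \<i> * integral UNIV (\<lambda>t. f (Complex c t))"
    by (rule contour_integral_eq_vertical_integral) (use L A B in \<open>auto simp: meijer_contour_def\<close>)
  moreover have "integral UNIV (\<lambda>t. f (Complex c t)) = (\<integral>t. f (Complex c t) \<partial>lborel)"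
  proof -
    have off: "Re s \<noteq> c" if "s \<in> A \<union> B" for s using A B that by force
    have "continuous_on UNIV (\<lambda>t. f (Complex c t))"
    proof (rule continuous_on_compose2[OF holomorphic_on_imp_continuous_on[OF holomorphic]])
      show "continuous_on UNIV (Complex c)"
        by (simp add: Complex_eq[abs_def] continuous_intros)
      show "Complex c ` UNIV \<subseteq> - (A \<union> B)" using off by force
    qed
    then have "(\<lambda>t. f (Complex c t)) \<in> borel_measurable lborel"
      using borel_measurable_continuous_onI by simp
    moreover have "(\<lambda>t. f (Complex c t)) absolutely_integrable_on UNIV"
      using off by (rule vertical_integrable)
    ultimately have "integrable lborel (\<lambda>t. f (Complex c t))"
      by (simp add: set_integrable_def integrable_completion)
    then show ?thesis by (rule integral_lborel)
  qed
  ultimately show ?thesis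
    by (simp add: meijer_G_def L_def[symmetric] f_def[symmetric] Let_def field_simps)
qed

text \<open>Collapses Gamma(\<beta> - s) / Gamma(\<beta> - s + 1). At negative integers
  \<open>a\<close> the left-hand side would be 0 by the convention for \<open>Gamma\<close> at its
  poles.\<close>

lemma Gamma_times_rGamma_plus1:
  fixes a :: complex
  assumes "a \<notin> \<int>\<^sub>\<le>\<^sub>0"
  shows "Gamma a * rGamma (a + 1) = 1 / a"
proof -
  have "a \<noteq> 0" "rGamma a \<noteq> 0" using assms by (auto simp: rGamma_eq_zero_iff)
  then show ?thesis using rGamma_plus1[of a] by (simp add: Gamma_def field_simps)
qed

section \<open>The G-function with the parameters of the theorem\<close>

context
  fixes r :: nat and p \<beta> z :: real and as bs :: "complex list"
  assumes r: "r \<in> {1, 2}" and p: "p > 0" and \<beta>: "\<beta> > 0" and z: "z > 0"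
    and as_def: "as = [of_real (1 - p - \<beta>), of_real (1 - \<beta>)]"
    and bs_def: "bs = (if r = 1 then [0] else [0, 1 / 2]) @ [of_real (- \<beta>)]"
begin

private lemma integrand_expand:
  "meijer_integrand r 2 as bs (of_real z) s =
     (if r = 1 then Gamma s else Gamma s * Gamma (s + 1 / 2)) *
     (Gamma (of_real (p + \<beta>) - s) * Gamma (of_real \<beta> - s)) * rGamma (of_real \<beta> - s + 1) * of_real z powr (- s)"
proof -
  \<comment> \<open>Valid also at the poles of the denominator, where both sides are 0. As
    \<open>rGamma\<close> is entire, holomorphy can fail only at poles of the numerator.\<close>
  have div: "x / Gamma (1 - of_real (- \<beta>) - s) = x * rGamma (of_real \<beta> - s + 1)" for x
    by (simp add: Gamma_def divide_inverse algebra_simps)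
  have n: "(\<Prod>i<2. Gamma (1 - as ! i - s)) = Gamma (of_real (p + \<beta>) - s) * Gamma (of_real \<beta> - s)"
    by (simp add: as_def lessThan_Suc numeral_2_eq_2)
  have d1: "(\<Prod>i=2..<length as. Gamma (as ! i + s)) = 1" by (simp add: as_def)
  have d2: "(\<Prod>i=r..<length bs. Gamma (1 - bs ! i - s)) = Gamma (1 - of_real (- \<beta>) - s)"
    using r by (auto simp: bs_def)
  have m: "(\<Prod>i<r. Gamma (bs ! i + s)) = (if r = 1 then Gamma s else Gamma s * Gamma (s + 1 / 2))"
    using r by (auto simp: bs_def lessThan_Suc numeral_2_eq_2 add.commute)
  show ?thesis
    unfolding meijer_integrand_def n d1 d2 m mult_1_left div ..
qed

private lemma poles_eq:
  "{s. \<exists>i<r. bs ! i + s \<in> \<int>\<^sub>\<le>\<^sub>0} = {s. s \<in> \<int>\<^sub>\<le>\<^sub>0 \<or> r = 2 \<and> 1 / 2 + s \<in> \<int>\<^sub>\<le>\<^sub>0}"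
  "{s. \<exists>i<2. 1 - as ! i - s \<in> \<int>\<^sub>\<le>\<^sub>0} = {s. of_real (p + \<beta>) - s \<in> \<int>\<^sub>\<le>\<^sub>0 \<or> of_real \<beta> - s \<in> \<int>\<^sub>\<le>\<^sub>0}"
proof -
  have ex2: "(\<exists>i<2. Q i) \<longleftrightarrow> Q 0 \<or> Q 1" for Q :: "nat \<Rightarrow> bool"
    by (auto simp: less_2_cases_iff)
  show "{s. \<exists>i<r. bs ! i + s \<in> \<int>\<^sub>\<le>\<^sub>0} = {s. s \<in> \<int>\<^sub>\<le>\<^sub>0 \<or> r = 2 \<and> 1 / 2 + s \<in> \<int>\<^sub>\<le>\<^sub>0}"
    using r by (cases "r = 1") (simp_all add: bs_def ex2)
  show "{s. \<exists>i<2. 1 - as ! i - s \<in> \<int>\<^sub>\<le>\<^sub>0} = {s. of_real (p + \<beta>) - s \<in> \<int>\<^sub>\<le>\<^sub>0 \<or> of_real \<beta> - s \<in> \<int>\<^sub>\<le>\<^sub>0}"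
    unfolding ex2 by (simp add: as_def)
qed

text \<open>For r = 2, Legendre's formula Gamma(s) Gamma(s + 1/2) = 2^(1 - 2 s) sqrt(pi) Gamma(2 s)
  is used; 2^(-2 s) = 4^(-s) is absorbed into z^(-s). This is the origin of r^r, and the prefactor
  is 1 for r = 1 and 2 sqrt(pi) for r = 2.\<close>

private lemma integrand_off_poles:
  assumes "s \<notin> \<int>\<^sub>\<le>\<^sub>0" "r = 2 \<Longrightarrow> 1 / 2 + s \<notin> \<int>\<^sub>\<le>\<^sub>0" "of_real \<beta> - s \<notin> \<int>\<^sub>\<le>\<^sub>0"
  shows "meijer_integrand r 2 as bs (of_real z) s =
    of_real ((2 * pi) powr ((real r - 1) / 2) * sqrt (real r)) *
      (Gamma (of_real (real r) * s) * Gamma (of_real (p + \<beta>) - s) / (of_real \<beta> - s) *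
        of_real (real r ^ r * z) powr (- s))"
proof -
  have *: "Gamma (of_real \<beta> - s) * rGamma (of_real \<beta> - s + 1) = 1 / (of_real \<beta> - s)"
    using assms by (intro Gamma_times_rGamma_plus1)
  define X where "X = (if r = 1 then Gamma s else Gamma s * Gamma (s + 1 / 2))"
  have X: "X * of_real z powr (- s) =
     of_real ((2 * pi) powr ((real r - 1) / 2) * sqrt (real r)) * Gamma (of_real (real r) * s) * of_real (real r ^ r * z) powr (- s)"
  proof (cases "r = 1")
    case False
    then have r2: "r = 2" using r by auto
    have K: "(2 * pi) powr ((real r - 1) / 2) * sqrt (real r) = 2 * sqrt pi"
      by (simp add: r2 powr_half_sqrt real_sqrt_mult)
    have "complex_of_real (4 * z) powr (- s) = exp (- s * of_real (ln (4 * z)))"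
      using z by (simp add: powr_def Ln_of_real del: of_real_mult)
    also have "ln (4 * z) = 2 * ln 2 + ln z"
      using z ln_realpow[of 2 2] by (simp add: ln_mult)
    also have "exp (- s * of_real (2 * ln 2 + ln z)) = exp (- (2 * s * of_real (ln 2))) * of_real z powr (- s)"
      using z by (simp add: powr_def Ln_of_real exp_add[symmetric] algebra_simps)
    finally have w: "complex_of_real (4 * z) powr (- s) = exp (- (2 * s * of_real (ln 2))) * of_real z powr (- s)" .
    have "exp ((1 - 2 * s) * of_real (ln 2)) = exp (of_real (ln 2)) * exp (- (2 * s * of_real (ln 2)))"
      by (simp only: exp_add[symmetric]) (simp add: algebra_simps)
    also have "exp (of_real (ln 2)) = (2 :: complex)"
      by (simp only: exp_of_real) simp
    finally have "exp ((1 - 2 * s) * of_real (ln 2)) = 2 * exp (- (2 * s * of_real (ln 2)))" .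
    moreover have "Gamma s * Gamma (s + 1 / 2) = exp ((1 - 2 * s) * of_real (ln 2)) * of_real (sqrt pi) * Gamma (2 * s)"
      using assms r2 by (intro Gamma_legendre_duplication) (auto simp: add.commute)
    ultimately show ?thesis using K w by (simp add: r2 X_def)
  qed (auto simp: X_def)
  have "meijer_integrand r 2 as bs (of_real z) s = (X * of_real z powr (- s)) *
      Gamma (of_real (p + \<beta>) - s) * (Gamma (of_real \<beta> - s) * rGamma (of_real \<beta> - s + 1))"
    unfolding integrand_expand X_def by (simp only: mult_ac)
  then show ?thesis unfolding X * by (simp only: mult_ac divide_inverse mult_1_left)
qed

text \<open>The quadratic decay is taken from Gamma(r s) alone. For |Im s| \<ge> 1 the remaining
  factors are merely bounded: Gamma(p + \<beta> - s) by the strip estimate with exponent 0, 1 /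
  (\<beta> - s) by 1, and the power by \<open>C3\<close>.\<close>

private lemma integrand_decay:
  "\<exists>C\<ge>0. \<forall>s. a \<le> Re s \<and> Re s \<le> b \<and> \<bar>Im s\<bar> \<ge> 1 \<longrightarrow>
     norm (meijer_integrand r 2 as bs (of_real z) s) \<le> C / (Im s)\<^sup>2"
proof -
  obtain C1 where C1: "C1 \<ge> 0" "\<And>s. real r * a \<le> Re s \<Longrightarrow> Re s \<le> real r * b \<Longrightarrow> \<bar>Im s\<bar> \<ge> 1 \<Longrightarrow> norm (Gamma s) \<le> C1 / \<bar>Im s\<bar> ^ 2"
    using Gamma_strip_decay[of "real r * a" "real r * b" 2] by blast
  obtain C2 where C2: "C2 \<ge> 0" "\<And>s. p + \<beta> - b \<le> Re s \<Longrightarrow> Re s \<le> p + \<beta> - a \<Longrightarrow> \<bar>Im s\<bar> \<ge> 1 \<Longrightarrow> norm (Gamma s) \<le> C2 / \<bar>Im s\<bar> ^ 0"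
    using Gamma_strip_decay[of "p + \<beta> - b" "p + \<beta> - a" 0] by blast
  define w where "w = real r ^ r * z"
  have w: "w > 0" using r z by (auto simp: w_def)
  define K where "K = (2 * pi) powr ((real r - 1) / 2) * sqrt (real r)"
  have K: "K \<ge> 0" by (simp add: K_def)
  define C3 where "C3 = exp (\<bar>ln w\<bar> * (\<bar>a\<bar> + \<bar>b\<bar>))"
  show ?thesis
  proof (intro exI conjI allI impI)
    show "0 \<le> K * (C1 * C2 * C3)" using K C1 C2 by (simp add: C3_def)
    fix s assume s: "a \<le> Re s \<and> Re s \<le> b \<and> \<bar>Im s\<bar> \<ge> 1"
    have im: "u \<notin> \<int>\<^sub>\<le>\<^sub>0" if "Im u \<noteq> 0" for u :: complex
      using that by (auto elim!: nonpos_Ints_cases')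
    have r1: "real r \<ge> 1" using r by auto
    have "1 * 1 \<le> real r * \<bar>Im s\<bar>" using r1 s by (intro mult_mono) auto
    then have "norm (Gamma (of_real (real r) * s)) \<le> C1 / \<bar>real r * Im s\<bar> ^ 2"
      using C1(2)[of "of_real (real r) * s"] s r1 by (auto simp: mult_left_mono abs_mult)
    also have "\<dots> \<le> C1 / (Im s)\<^sup>2"
    proof (rule divide_left_mono)
      have "\<bar>Im s\<bar> ^ 2 \<le> \<bar>real r * Im s\<bar> ^ 2"
        using r1 by (intro power_mono) (auto simp: abs_mult mult_le_cancel_right1)
      then show "(Im s)\<^sup>2 \<le> \<bar>real r * Im s\<bar> ^ 2" by simp
    qed (use C1(1) s r1 in auto)
    finally have 1: "norm (Gamma (of_real (real r) * s)) \<le> C1 / (Im s)\<^sup>2" .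
    have 2: "norm (Gamma (of_real (p + \<beta>) - s)) \<le> C2" using C2(2)[of "of_real (p + \<beta>) - s"] s by auto
    have 3: "norm (of_real w powr (- s)) \<le> C3"
    proof -
      have "norm (of_real w powr (- s)) = exp (- Re s * ln w)"
        using w by (simp add: norm_powr_real_powr powr_def)
      also have "- Re s * ln w \<le> \<bar>ln w\<bar> * (\<bar>a\<bar> + \<bar>b\<bar>)"
      proof -
        have "- Re s * ln w \<le> \<bar>ln w\<bar> * \<bar>Re s\<bar>" by (metis abs_ge_self abs_minus_cancel abs_mult mult.commute)
        also have "\<dots> \<le> \<bar>ln w\<bar> * (\<bar>a\<bar> + \<bar>b\<bar>)" using s by (intro mult_left_mono) auto
        finally show ?thesis .
      qed
      finally show ?thesis by (simp add: C3_def)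
    qed
    have 4: "norm (1 / (of_real \<beta> - s)) \<le> 1"
      using s abs_Im_le_cmod[of "of_real \<beta> - s"] by (auto simp: norm_divide divide_simps)
    have "meijer_integrand r 2 as bs (of_real z) s =
       of_real K * (Gamma (of_real (real r) * s) * Gamma (of_real (p + \<beta>) - s) * of_real w powr (- s) * (1 / (of_real \<beta> - s)))"
      using s unfolding K_def w_def by (subst integrand_off_poles) (auto intro!: im simp: mult_ac)
    then have "norm (meijer_integrand r 2 as bs (of_real z) s) =
       K * (norm (Gamma (of_real (real r) * s)) * norm (Gamma (of_real (p + \<beta>) - s)) * norm (of_real w powr (- s)) * norm (1 / (of_real \<beta> - s)))"
      using K by (simp only: norm_mult norm_of_real abs_of_nonneg)
    also have "\<dots> \<le> K * (C1 / (Im s)\<^sup>2 * C2 * C3 * 1)"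
    proof -
      have "norm (Gamma (of_real (real r) * s)) * norm (Gamma (of_real (p + \<beta>) - s)) \<le> C1 / (Im s)\<^sup>2 * C2"
        by (rule mult_mono[OF 1 2]) (use C1(1) in auto)
      then have "norm (Gamma (of_real (real r) * s)) * norm (Gamma (of_real (p + \<beta>) - s)) * norm (of_real w powr (- s))
          \<le> C1 / (Im s)\<^sup>2 * C2 * C3"
        by (rule mult_mono[OF _ 3]) (use C1(1) C2(1) in auto)
      then have "norm (Gamma (of_real (real r) * s)) * norm (Gamma (of_real (p + \<beta>) - s)) * norm (of_real w powr (- s))
          * norm (1 / (of_real \<beta> - s)) \<le> C1 / (Im s)\<^sup>2 * C2 * C3 * 1"
        by (rule mult_mono[OF _ 4]) (use C1(1) C2(1) in \<open>auto simp: C3_def\<close>)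
      then show ?thesis by (rule mult_left_mono) (rule K)
    qed
    finally show "norm (meijer_integrand r 2 as bs (of_real z) s) \<le> K * (C1 * C2 * C3) / (Im s)\<^sup>2"
      by simp
  qed
qed

text \<open>The set lists the poles of the individual numerator factors, because these are what
  \<open>meijer_contour\<close> separates. At \<beta> + 1, \<beta> + 2, ... the pole of
  Gamma(\<beta> - s) meets a zero of \<open>rGamma (of_real \<beta> - s + 1)\<close>, yet the
  contour still has these points on its right.\<close>

private lemma integrand_mellin_barnes:
  "mellin_barnes_integrand (meijer_integrand r 2 as bs (of_real z))
      ({s. \<exists>i<r. bs ! i + s \<in> \<int>\<^sub>\<le>\<^sub>0} \<union> {s. \<exists>i<2. 1 - as ! i - s \<in> \<int>\<^sub>\<le>\<^sub>0})" (is "mellin_barnes_integrand _ ?P")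
proof
  show "meijer_integrand r 2 as bs (of_real z) holomorphic_on - ?P"
    unfolding poles_eq integrand_expand[abs_def] using r z
    by (cases "r = 1") (auto intro!: holomorphic_intros simp: add.commute)
  show "Im s = 0" if "s \<in> ?P" for s
    using that unfolding poles_eq by (auto elim!: nonpos_Ints_cases' simp: complex_eq_iff)
  show "finite {s \<in> ?P. \<bar>Re s\<bar> \<le> R}" for R
    unfolding poles_eq
    by (rule finite_subset[OF _ finite_UnI[OF finite_UnI[OF finite_Gamma_poles_strip(1)[of 0 R] finite_Gamma_poles_strip(1)[of "1/2" R]]
       finite_UnI[OF finite_Gamma_poles_strip(2)[of "of_real (p + \<beta>)" R] finite_Gamma_poles_strip(2)[of "of_real \<beta>" R]]]])
       auto
qed (rule integrand_decay)

theorem meijer_G_eq_incomplete_kernel_integral: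
  "meijer_G r 2 as bs (of_real z) =
     of_real ((2 * pi) powr ((real r - 1) / 2) / sqrt (real r) *
       (\<integral>x. indicator {0<..} x * (exp (- x) * x powr (p + \<beta> - 1) * incomplete_kernel r \<beta> (real r ^ r * z * x)) \<partial>lborel))"
proof -
  define D where "D = (\<integral>x. indicator {0<..} x * (exp (- x) * x powr (p + \<beta> - 1) * incomplete_kernel r \<beta> (real r ^ r * z * x)) \<partial>lborel)"
  \<comment> \<open>Any value strictly between 0 and \<beta> would do: the left poles have real part
    at most 0, the right ones at least \<beta>.\<close>
  define c where "c = \<beta> / 2"
  have c: "0 < c" "c < \<beta>" using \<beta> by (auto simp: c_def)
  have npos: "u \<notin> \<int>\<^sub>\<le>\<^sub>0" if "Re u > 0" for u :: complex
    using that by (auto elim!: nonpos_Ints_cases')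
  have "meijer_G r 2 as bs (of_real z) =
     (\<integral>t. meijer_integrand r 2 as bs (of_real z) (Complex c t) \<partial>lborel) / (2 * of_real pi)"
  proof (rule meijer_G_eq_vertical_integral[OF integrand_mellin_barnes])
    show "- Re (bs ! i) < c" if "i < r" for i
      using that r c by (auto simp: bs_def less_Suc_eq numeral_2_eq_2)
    show "c < 1 - Re (as ! i)" if "i < 2" for i
      using that c p by (auto simp: as_def less_Suc_eq numeral_2_eq_2)
  qed
  also have "(\<integral>t. meijer_integrand r 2 as bs (of_real z) (Complex c t) \<partial>lborel) =
     (\<integral>t. of_real ((2 * pi) powr ((real r - 1) / 2) * sqrt (real r)) *
      (Gamma (of_real (real r) * Complex c t) * Gamma (of_real (p + \<beta>) - Complex c t) / (of_real \<beta> - Complex c t) *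
        of_real (real r ^ r * z) powr (- Complex c t)) \<partial>lborel)"
    by (intro Bochner_Integration.integral_cong integrand_off_poles npos refl) (use c in auto)
  also have "\<dots> = of_real ((2 * pi) powr ((real r - 1) / 2) * sqrt (real r)) * of_real (2 * pi / real r * D)"
    unfolding integral_mult_right_zero D_def
    by (subst mellin_barnes_double_integral) (use r c p z in auto)
  finally have "meijer_G r 2 as bs (of_real z) =
     of_real ((2 * pi) powr ((real r - 1) / 2) * sqrt (real r) * (2 * pi / real r * D) / (2 * pi))"
    by simp
  also have "(2 * pi) powr ((real r - 1) / 2) * sqrt (real r) * (2 * pi / real r * D) / (2 * pi) =
     (2 * pi) powr ((real r - 1) / 2) / sqrt (real r) * D"
    using r by (auto simp: field_simps)
  finally show ?thesis by (simp only: D_def)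
qed

end

section \<open>The distribution of the signal-to-noise ratio\<close>

lemma incomplete_kernel_integrable:
  fixes \<beta> y r :: real
  assumes "\<beta> > 0"
  shows "integrable lborel (\<lambda>v. indicator {0<..<1} v * (v powr (\<beta> - 1) * exp (- ((y * v) powr (1 / r)))))"
proof (rule Bochner_Integration.integrable_bound)
  show "integrable lborel (\<lambda>v. indicator {0<..<1} v *\<^sub>R exp ((of_real \<beta> - 1) * complex_of_real (ln v)))"
    by (rule complex_powr_integral_0_1) (use assms in auto)
qed (auto simp: indicator_def powr_def)

lemma gamma_density_integral_eq_incomplete_kernel:
  fixes l k r Y :: real
  assumes l: "l > 0" and k: "k > 0" and r: "r > 0" and Y: "Y > 0"
  shows "(\<integral>y. indicator {0<..<Y} y * gamma_density l k y \<partial>lborel) =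
    Y powr l / (Gamma l * k powr l * r) * incomplete_kernel r (l / r) ((Y / k) powr r)"
proof -
  define g where "g = (\<lambda>v. Y * v powr (1 / r))"
  define g' where "g' = (\<lambda>v. Y * (1 / r * v powr (1 / r - 1)))"
  define K where "K = Y powr l / (Gamma l * k powr l * r)"
  define J where "J = (\<lambda>v. v powr (l / r - 1) * exp (- (((Y / k) powr r * v) powr (1 / r))))"
  have img: "g ` {0<..<1} = {0<..<Y}"
  proof (intro equalityI subsetI)
    fix y assume "y \<in> g ` {0<..<1}"
    then obtain v where v: "0 < v" "v < 1" "y = Y * v powr (1 / r)" by (auto simp: g_def)
    then have "v powr (1 / r) < 1 powr (1 / r)" using r by (intro powr_less_mono2) auto
    then show "y \<in> {0<..<Y}" using v Y by auto
  next
    fix y assume y: "y \<in> {0<..<Y}"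
    then have "(y / Y) powr r < 1 powr r" using r by (intro powr_less_mono2) auto
    moreover have "y = g ((y / Y) powr r)" using y r by (simp add: g_def powr_powr)
    ultimately show "y \<in> g ` {0<..<1}" using y by (intro image_eqI[of _ _ "(y / Y) powr r"]) auto
  qed
  have inj: "inj_on g {0<..<1}"
  proof (rule inj_onI)
    fix v w assume vw: "v \<in> {0<..<1}" "w \<in> {0<..<1}" "g v = g w"
    then have "v powr (1 / r) = w powr (1 / r)" using Y by (simp add: g_def)
    then have "(v powr (1 / r)) powr r = (w powr (1 / r)) powr r" by simp
    then show "v = w" using vw r by (simp add: powr_powr)
  qed
  have der: "(g has_field_derivative g' v) (at v within {0<..<1})" if "v \<in> {0<..<1}" for v
    unfolding g_def g'_def using that r
    by (auto intro!: derivative_eq_intros simp: powr_diff divide_simps)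
  have eq: "\<bar>g' v\<bar> * gamma_density l k (g v) = K * J v" if v: "v \<in> {0<..<1}" for v
  proof -
    have v0: "v > 0" using v by auto
    have e: "((Y / k) powr r * v) powr (1 / r) = g v / k"
      using v0 Y k r by (simp add: powr_mult powr_powr g_def)
    have 1: "g v powr (l - 1) = Y powr (l - 1) * v powr ((l - 1) / r)"
      using v0 Y by (simp add: g_def powr_mult powr_powr)
    \<comment> \<open>The Jacobian contributes 1/r - 1 and the density (l - 1)/r; this is why the
      kernel has parameter l/r.\<close>
    have 2: "v powr (1 / r - 1) * v powr ((l - 1) / r) = v powr (l / r - 1)"
      by (simp add: powr_add[symmetric] add_divide_distrib[symmetric] diff_divide_distrib)
    have 3: "Y * Y powr (l - 1) = Y powr l" using Y by (simp add: powr_mult_base)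
    have 4: "g v > 0" using v0 Y by (simp add: g_def)
    have 5: "\<bar>g' v\<bar> = Y * (1 / r * v powr (1 / r - 1))" using Y r by (simp add: g'_def)
    have "\<bar>g' v\<bar> * gamma_density l k (g v) =
       (Y * Y powr (l - 1)) * (v powr (1 / r - 1) * v powr ((l - 1) / r)) / (Gamma l * k powr l * r) * exp (- (g v / k))"
      unfolding gamma_density_def 1 5 using 4 by (simp add: divide_inverse mult_ac)
    also have "\<dots> = K * J v"
      unfolding J_def e K_def 2 3
      by simp
    finally show ?thesis .
  qed
  have intJ: "integrable lborel (\<lambda>v. indicator {0<..<1} v * J v)"
    unfolding J_def by (rule incomplete_kernel_integrable) (use l r in auto)
  then have J1: "set_integrable lborel {0<..<1} J" by (simp add: set_integrable_def)
  then have "(\<lambda>v. indicator {0<..<1} v *\<^sub>R J v) \<in> borel_measurable lborel"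
    unfolding set_integrable_def by (rule borel_measurable_integrable)
  with J1 have J2: "J absolutely_integrable_on {0<..<1}"
    by (simp only: set_integrable_def integrable_completion)
  have J3: "integral {0<..<1} J = incomplete_kernel r (l / r) ((Y / k) powr r)"
    using set_borel_integral_eq_integral(2)[OF J1]
    by (simp add: incomplete_kernel_def J_def set_lebesgue_integral_def)
  have "(\<lambda>v. \<bar>g' v\<bar> * gamma_density l k (g v)) absolutely_integrable_on {0<..<1} \<longleftrightarrow>
      (\<lambda>v. K * J v) absolutely_integrable_on {0<..<1}"
    by (rule set_integrable_cong) (auto simp: eq)
  moreover have "(\<lambda>v. K * J v) absolutely_integrable_on {0<..<1}"
    by (rule set_integrable_mult_right) (rule J2)
  moreover have "integral {0<..<1} (\<lambda>v. \<bar>g' v\<bar> * gamma_density l k (g v)) = integral {0<..<1} (\<lambda>v. K * J v)"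
    by (rule integral_cong) (auto simp: eq)
  moreover have "integral {0<..<1} (\<lambda>v. K * J v) = K * incomplete_kernel r (l / r) ((Y / k) powr r)"
    unfolding J3[symmetric] by (rule integral_mult_right)
  ultimately have "(\<lambda>v. \<bar>g' v\<bar> * gamma_density l k (g v)) absolutely_integrable_on {0<..<1} \<and>
      integral {0<..<1} (\<lambda>v. \<bar>g' v\<bar> * gamma_density l k (g v)) = K * incomplete_kernel r (l / r) ((Y / k) powr r)"
    by simp
  \<comment> \<open>The change of variables theorem is an equivalence, so integrability of the
    density is inherited from that of the kernel.\<close>
  then have G: "gamma_density l k absolutely_integrable_on {0<..<Y}"
     "integral {0<..<Y} (gamma_density l k) = K * incomplete_kernel r (l / r) ((Y / k) powr r)"
    using has_absolute_integral_change_of_variables_1'[OF _ der inj, of "gamma_density l k"] unfolding img by auto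
  have "gamma_density l k \<in> borel_measurable borel"
    unfolding gamma_density_def by measurable
  then have "set_integrable lborel {0<..<Y} (gamma_density l k)"
    using G(1) by (simp add: set_integrable_def integrable_completion)
  from set_borel_integral_eq_integral(2)[OF this] G(2) show ?thesis
    by (simp add: set_lebesgue_integral_def K_def)
qed

lemma cdf_snr:
  fixes l k E \<mu> x :: real and r :: nat
  assumes "prob_space Q" and X: "distributed Q lborel X (\<lambda>y. ennreal (gamma_density l k y))"
    and pos: "l > 0" "k > 0" "E > 0" "\<mu> > 0" "x > 0" and r: "r > 0"
  shows "cdf (distr Q borel (\<lambda>\<omega>. \<mu> * (X \<omega> / E) ^ r)) x =
    E powr l / (Gamma l * k powr l * r) * (x / \<mu>) powr (l / r) * incomplete_kernel r (l / r) ((E / k) ^ r / \<mu> * x)"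
proof -
  define Y where "Y = E * (x / \<mu>) powr (1 / r)"
  have Y: "Y > 0" using pos by (simp add: Y_def)
  have gm [measurable]: "gamma_density l k \<in> borel_measurable borel"
    unfolding gamma_density_def by measurable
  have gnn: "gamma_density l k y \<ge> 0" for y
    using pos by (simp add: gamma_density_def)
  have Xm [measurable]: "X \<in> borel_measurable Q" using X by (simp add: distributed_def)
  define A where "A = {y. \<mu> * (y / E) ^ r \<le> x}"
  have A [measurable]: "A \<in> sets borel" unfolding A_def by measurable
  have "cdf (distr Q borel (\<lambda>\<omega>. \<mu> * (X \<omega> / E) ^ r)) x = measure Q ((\<lambda>\<omega>. \<mu> * (X \<omega> / E) ^ r) -` {..x} \<inter> space Q)"
    unfolding cdf_def by (rule measure_distr) auto
  also have "(\<lambda>\<omega>. \<mu> * (X \<omega> / E) ^ r) -` {..x} \<inter> space Q = X -` A \<inter> space Q"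
    by (auto simp: A_def)
  also have "measure Q \<dots> = measure (distr Q lborel X) A"
    by (rule measure_distr[symmetric]) auto
  also have "\<dots> = measure (density lborel (\<lambda>y. ennreal (gamma_density l k y))) A"
    using X by (simp add: distributed_def)
  also have "\<dots> = (\<integral>y. indicator A y \<partial>density lborel (\<lambda>y. ennreal (gamma_density l k y)))"
    by simp
  also have "\<dots> = (\<integral>y. gamma_density l k y *\<^sub>R indicator A y \<partial>lborel)"
    by (rule integral_density) (auto simp: gnn)
  also have "\<dots> = (\<integral>y. indicator {0<..<Y} y * gamma_density l k y \<partial>lborel)"
  \<comment> \<open>\<open>A\<close> may contain points y \<le> 0, where the density vanishes; for y
    > 0 it is the interval up to and including \<open>Y\<close>, which differs from the open one by
    a null set.\<close>
  proof (rule integral_cong_AE)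
    have "AE y in lborel. y \<noteq> Y" by (rule AE_lborel_singleton)
    then show "AE y in lborel. gamma_density l k y *\<^sub>R indicator A y = indicator {0<..<Y} y * gamma_density l k y"
    proof eventually_elim
      fix y assume y: "y \<noteq> Y"
      show "gamma_density l k y *\<^sub>R indicator A y = indicator {0<..<Y} y * gamma_density l k y"
      proof (cases "y > 0")
        case True
        have "\<mu> * (y / E) ^ r \<le> x \<longleftrightarrow> (y / E) ^ r \<le> x / \<mu>" using pos by (simp add: field_simps)
        also have "x / \<mu> = (Y / E) ^ r"
          using pos r by (simp add: Y_def powr_powr flip: powr_realpow)
        also have "(y / E) ^ r \<le> (Y / E) ^ r \<longleftrightarrow> y / E \<le> Y / E"
          using True Y pos r by (intro power_mono_iff) auto
        also have "\<dots> \<longleftrightarrow> y \<le> Y" using pos by (simp add: divide_le_cancel)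
        finally have "y \<in> A \<longleftrightarrow> y \<in> {0<..<Y}" using True y by (auto simp: A_def)
        then show ?thesis by (simp add: indicator_def)
      qed (simp add: gamma_density_def)
    qed
  qed measurable
  also have "\<dots> = Y powr l / (Gamma l * k powr l * real r) * incomplete_kernel (real r) (l / real r) ((Y / k) powr real r)"
    by (rule gamma_density_integral_eq_incomplete_kernel) (use pos Y r in auto)
  also have "Y powr l = E powr l * (x / \<mu>) powr (l / r)"
    using pos by (simp add: Y_def powr_mult powr_powr)
  also have "(Y / k) powr real r = (E / k) ^ r / \<mu> * x"
  proof -
    have "((x / \<mu>) powr (1 / r)) ^ r = x / \<mu>"
      using pos r by (simp add: powr_powr flip: powr_realpow)
    then have "(E * (x / \<mu>) powr (1 / r) / k) ^ r = (E / k) ^ r * (x / \<mu>)"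
      by (simp add: power_mult_distrib power_divide)
    moreover have "(Y / k) powr real r = (Y / k) ^ r" using Y pos by (simp add: powr_realpow)
    ultimately show ?thesis by (simp add: Y_def)
  qed
  finally show ?thesis by (simp add: mult_ac)
qed

text \<open>Rescaling by \<open>q\<close> replaces \<kappa> by \<kappa> / q, and the powers of
  \<open>q\<close> combine as p + (1 - p - \<beta>) - 1 = -\<beta>.\<close>

lemma average_ber_eq_incomplete_kernel_integral:
  fixes p q \<beta> C \<kappa> r :: real
  assumes q: "q > 0" and F: "\<And>x. x > 0 \<Longrightarrow> F x = C * x powr \<beta> * incomplete_kernel r \<beta> (\<kappa> * x)"
  shows "average_ber p q F = C * q powr (- \<beta>) / (2 * Gamma p) *
    (\<integral>x. indicator {0<..} x * (exp (- x) * x powr (p + \<beta> - 1) * incomplete_kernel r \<beta> (\<kappa> / q * x)) \<partial>lborel)"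
proof -
  define G where "G x = indicator {0<..} x * (exp (- q * x) * x powr (p - 1) * (C * x powr \<beta> * incomplete_kernel r \<beta> (\<kappa> * x)))" for x
  have "average_ber p q F = q powr p / (2 * Gamma p) * (\<integral>x. G x \<partial>lborel)"
    unfolding average_ber_def set_lebesgue_integral_def
    by (rule arg_cong2[where f = "(*)"], simp, rule Bochner_Integration.integral_cong)
       (auto simp: G_def F indicator_def)
  also have "(\<integral>x. G x \<partial>lborel) = \<bar>1 / q\<bar> *\<^sub>R (\<integral>x. G (0 + 1 / q * x) \<partial>lborel)"
    by (rule lborel_integral_real_affine) (use q in auto)
  also have "(\<lambda>x. G (0 + 1 / q * x)) = (\<lambda>x. (C * q powr (1 - p - \<beta>)) *
     (indicator {0<..} x * (exp (- x) * x powr (p + \<beta> - 1) * incomplete_kernel r \<beta> (\<kappa> / q * x))))"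
  proof
    fix x
    show "G (0 + 1 / q * x) = (C * q powr (1 - p - \<beta>)) *
     (indicator {0<..} x * (exp (- x) * x powr (p + \<beta> - 1) * incomplete_kernel r \<beta> (\<kappa> / q * x)))"
    proof (cases "x > 0")
      case True
      have "(x / q) powr (p - 1) * (x / q) powr \<beta> = (x / q) powr (p + \<beta> - 1)"
        by (simp add: powr_add[symmetric] algebra_simps)
      also have "\<dots> = x powr (p + \<beta> - 1) * q powr (1 - p - \<beta>)"
        using True q by (simp add: powr_divide divide_powr_uminus algebra_simps)
      finally have "(x / q) powr (p - 1) * (x / q) powr \<beta> = x powr (p + \<beta> - 1) * q powr (1 - p - \<beta>)" .
      moreover have "G (0 + 1 / q * x) = exp (- x) * ((x / q) powr (p - 1) * (x / q) powr \<beta>) * (C * incomplete_kernel r \<beta> (\<kappa> / q * x))"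
        using True q by (simp add: G_def)
      ultimately show ?thesis using True by simp
    qed (use q in \<open>auto simp: G_def zero_less_divide_iff\<close>)
  qed
  also have "q powr p / (2 * Gamma p) * (\<bar>1 / q\<bar> *\<^sub>R (\<integral>x. (C * q powr (1 - p - \<beta>)) *
     (indicator {0<..} x * (exp (- x) * x powr (p + \<beta> - 1) * incomplete_kernel r \<beta> (\<kappa> / q * x))) \<partial>lborel)) =
     C * (q powr p * q powr (1 - p - \<beta>) * inverse q) / (2 * Gamma p) *
    (\<integral>x. indicator {0<..} x * (exp (- x) * x powr (p + \<beta> - 1) * incomplete_kernel r \<beta> (\<kappa> / q * x)) \<partial>lborel)"
  proof -
    have "\<bar>1 / q\<bar> = inverse q" using q by (simp add: inverse_eq_divide)
    then show ?thesis
      unfolding integral_mult_right_zero real_scaleR_def divide_inverse by (simp only: mult_ac)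
  qed
  also have "q powr p * q powr (1 - p - \<beta>) * inverse q = q powr (- \<beta>)"
  proof -
    have "q powr p * q powr (1 - p - \<beta>) * inverse q = q powr p * q powr (1 - p - \<beta>) * q powr (- 1)"
      using q by (simp add: powr_minus)
    also have "\<dots> = q powr (- \<beta>)" by (simp only: powr_add[symmetric]) simp
    finally show ?thesis .
  qed
  finally show ?thesis .
qed

theorem mainTheorem3:
  fixes P :: "'a measure" and M :: "'a \<Rightarrow> real"
    and Q :: "'b measure" and Mbar \<gamma>d :: "'b \<Rightarrow> real"
    and E V l k \<mu> p q \<Lambda>3 \<Lambda>4 :: real and Nd r :: nat
  assumes "prob_space P"
    and M_pos: "AE \<omega> in P. M \<omega> > 0"
    and M_mean: "integrable P M" "E = prob_space.expectation P M"
    and M_var: "integrable P (\<lambda>\<omega>. (M \<omega>)\<^sup>2)" "V = prob_space.variance P M" "V > 0"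
    and Nd: "Nd \<ge> 1"
    and l_def: "l = real Nd * E\<^sup>2 / V"
    and k_def: "k = V / E"
    and "prob_space Q"
    and Mbar: "distributed Q lborel Mbar (\<lambda>y. ennreal (gamma_density l k y))"
    and r: "r \<in> {1, 2}"
    and \<mu>: "\<mu> > 0"
    and snr: "\<gamma>d = (\<lambda>\<omega>. \<mu> * (Mbar \<omega> / E) ^ r)"
    and pq: "p > 0" "q > 0"
    and \<Lambda>3_def: "\<Lambda>3 = E powr l / (Gamma l * k powr l * (2 * pi) powr ((real r - 1) / 2))"
    and \<Lambda>4_def: "\<Lambda>4 = (E / (k * real r)) ^ r"
  shows "complex_of_real (average_ber p q (cdf (distr Q borel \<gamma>d))) =
    complex_of_real (\<Lambda>3 * q powr (- l / real r) /
                     (2 * sqrt (real r) * Gamma p * \<mu> powr (l / real r))) *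
    meijer_G r 2
      [complex_of_real (1 - p - l / real r), complex_of_real (1 - l / real r)]
      ((if r = 1 then [0] else [0, 1 / 2]) @ [complex_of_real (- l / real r)])
      (complex_of_real (\<Lambda>4 / (q * \<mu>)))"
proof -
  interpret P: prob_space P by fact
  \<comment> \<open>A vanishing mean would force the almost surely positive \<open>M\<close> to be 0
    almost everywhere. Positivity of \<open>l\<close> and \<open>k\<close> rests on this.\<close>
  have "E > 0"
  proof -
    have "E \<ge> 0"
      unfolding M_mean(2) by (rule integral_nonneg_AE) (use M_pos in eventually_elim; simp)
    moreover have "E \<noteq> 0"
    proof
      assume "E = 0"
      have "AE \<omega> in P. 0 \<le> M \<omega>" using M_pos by eventually_elim simp
      then have "AE \<omega> in P. M \<omega> = 0"
        using integral_nonneg_eq_0_iff_AE[OF M_mean(1)] M_mean(2) \<open>E = 0\<close> by simp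
      with M_pos have "AE \<omega> in P. False" by eventually_elim simp
      then show False using P.AE_False by simp
    qed
    ultimately show ?thesis by simp
  qed
  then have pos: "l > 0" "k > 0" using M_var(3) Nd by (auto simp: l_def k_def)
  define \<beta> where "\<beta> = l / real r"
  define z where "z = \<Lambda>4 / (q * \<mu>)"
  have r0: "r > 0" using r by auto
  have \<beta>: "\<beta> > 0" using pos r0 by (simp add: \<beta>_def)
  have z: "z > 0" using \<open>E > 0\<close> pos r0 pq \<mu> by (simp add: z_def \<Lambda>4_def)
  define D where "D = (\<integral>x. indicator {0<..} x * (exp (- x) * x powr (p + \<beta> - 1) * incomplete_kernel r \<beta> (real r ^ r * z * x)) \<partial>lborel)"
  define C where "C = E powr l / (Gamma l * k powr l * r) * \<mu> powr (- \<beta>)"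
  define T where "T = (2 * pi) powr ((real r - 1) / 2)"
  have T: "T > 0" by (simp add: T_def)
  have F: "cdf (distr Q borel \<gamma>d) x = C * x powr \<beta> * incomplete_kernel r \<beta> ((E / k) ^ r / \<mu> * x)" if "x > 0" for x
  proof -
    have "(x / \<mu>) powr \<beta> = x powr \<beta> * \<mu> powr (- \<beta>)"
      using that \<mu> by (simp add: powr_divide powr_minus_divide)
    moreover have "cdf (distr Q borel \<gamma>d) x =
       E powr l / (Gamma l * k powr l * r) * (x / \<mu>) powr (l / r) * incomplete_kernel r (l / r) ((E / k) ^ r / \<mu> * x)"
      unfolding snr by (rule cdf_snr) (use assms pos \<open>E > 0\<close> that r0 in auto)
    ultimately show ?thesis by (simp add: C_def \<beta>_def)
  qed
  \<comment> \<open>The \<open>r\<close> in the denominator of \<Lambda>4 compensates the r^r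
    produced by the duplication formula.\<close>
  have "(E / k) ^ r / \<mu> / q = real r ^ r * z"
    using r0 by (simp add: z_def \<Lambda>4_def power_divide power_mult_distrib field_simps)
  then have ber: "average_ber p q (cdf (distr Q borel \<gamma>d)) = C * q powr (- \<beta>) / (2 * Gamma p) * D"
    using average_ber_eq_incomplete_kernel_integral[OF pq(2) F, of p] by (simp add: D_def)
  have G: "meijer_G r 2
      [complex_of_real (1 - p - l / real r), complex_of_real (1 - l / real r)]
      ((if r = 1 then [0] else [0, 1 / 2]) @ [complex_of_real (- l / real r)])
      (complex_of_real (\<Lambda>4 / (q * \<mu>))) = of_real (T / sqrt (real r) * D)"
    unfolding T_def D_def z_def[symmetric] minus_divide_left[symmetric] \<beta>_def[symmetric]
    by (rule meijer_G_eq_incomplete_kernel_integral[OF r pq(1) \<beta> z refl refl])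
  \<comment> \<open>The power of 2 pi in \<Lambda>3 cancels the one in the G-function, and the two
    factors 1 / sqrt r give the 1 / r of the distribution function.\<close>
  have "\<Lambda>3 * q powr (- l / real r) / (2 * sqrt (real r) * Gamma p * \<mu> powr (l / real r)) * (T / sqrt (real r) * D)
     = C * q powr (- \<beta>) / (2 * Gamma p) * D"
  proof -
    have \<Lambda>3T: "\<Lambda>3 * T = E powr l / (Gamma l * k powr l)"
      using T by (simp add: \<Lambda>3_def flip: T_def)
    have "\<Lambda>3 * q powr (- l / real r) / (2 * sqrt (real r) * Gamma p * \<mu> powr (l / real r)) * (T / sqrt (real r) * D)
      = (\<Lambda>3 * T) * q powr (- \<beta>) * inverse (2 * Gamma p) * inverse (\<mu> powr \<beta>) * inverse (sqrt (real r) * sqrt (real r)) * D"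
      by (simp only: \<beta>_def minus_divide_left divide_inverse inverse_mult_distrib mult_ac mult_minus_left)
    also have "sqrt (real r) * sqrt (real r) = real r" by simp
    also have "(\<Lambda>3 * T) * q powr (- \<beta>) * inverse (2 * Gamma p) * inverse (\<mu> powr \<beta>) * inverse (real r) * D
      = C * q powr (- \<beta>) / (2 * Gamma p) * D"
      unfolding \<Lambda>3T C_def powr_minus[of \<mu>] by (simp only: divide_inverse inverse_mult_distrib mult_ac)
    finally show ?thesis .
  qed
  then show ?thesis unfolding ber G of_real_mult[symmetric] by simp
qed

end
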